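(* Let $h$ be any nonzero integer. For $X>0$, let $N(3,X)$ denote the number of $\mathrm{GL}_2(\mathbb{Z})$-classes of integral binary cubic forms $F(x,y)\in\mathbb{Z}[x,y]$ of nonzero discriminant with $|\mathrm{disc}(F)|<X$, and let $N_h(3,X)$ denote the number of those $\mathrm{GL}_2(\mathbb{Z})$-classes whose forms $F$ have all of the following properties: (i) $F$ locally everywhere represents $h$, i.e., $F(x,y)=h$ has a solution in $\mathbb{R}^2$ and in $\mathbb{Z}_p^2$ for all primes $p$; (ii) $F$ does not globally represent $h$, i.e., $F(x,y)=h$ has no solution in $\mathbb{Z}^2$; (iii) $F$ is maximal. Then $$\liminf_{X\to\infty}\frac{N_h(3,X)}{N(3,X)}>0.$$ That is, when $\mathrm{GL}_2(\mathbb{Z})$-classes of integral binary cubic forms are ordered by absolute discriminant, a positive proportion of them have properties (i), (ii) and (iii).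
   Context: An integral binary cubic form is a homogeneous polynomial $F(x,y)=a_0x^3+a_1x^2y+a_2xy^2+a_3y^3$ with $a_i\in\mathbb{Z}$. If $F(x,y)=\prod_{i=1}^{n}(\alpha_i x-\beta_i y)$ over $\mathbb{C}$ (here $n=3$), its discriminant is $\mathrm{disc}(F)=\prod_{i<j}(\alpha_i\beta_j-\alpha_j\beta_i)^2$. For $A=\begin{pmatrix}a&b\\c&d\end{pmatrix}$ put $F^A(x,y)=F(ax+by,cx+dy)$; two integral forms $F,G$ are in the same $\mathrm{GL}_2(\mathbb{Z})$-class (equivalent) if $G=F^A$ for some $A\in\mathrm{GL}_2(\mathbb{Z})$. An integral form $G$ is a proper subform of an integral form $F$ if $G=F^A$ for some $2\times 2$ integer matrix $A$ with $|\det A|>1$. An integral form is maximal if it is not a proper subform of any integral form. Properties (i)-(iii) depend only on the $\mathrm{GL}_2(\mathbb{Z})$-class of $F$. *)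

theory Defs
  imports "HOL-Analysis.Analysis" "HOL-Algebra.Ring" "HOL-Number_Theory.Cong"
    "HOL-Computational_Algebra.Fundamental_Theorem_Algebra"
begin

section \<open>Integral binary cubic forms\<close>

text \<open>\<^term>\<open>Cubic a b c d\<close> stands for the form
  $a x^3 + b x^2 y + c x y^2 + d y^3$ (the zero form is included).\<close>

datatype cubic = Cubic (cf0: int) (cf1: int) (cf2: int) (cf3: int)

definition form_eval :: "cubic \<Rightarrow> 'a::comm_ring_1 \<Rightarrow> 'a \<Rightarrow> 'a" where
  "form_eval F x y = of_int (cf0 F) * x ^ 3 + of_int (cf1 F) * x ^ 2 * y
     + of_int (cf2 F) * x * y ^ 2 + of_int (cf3 F) * y ^ 3"

lemma cubic_polynomial_coeffs_eqI:
  fixes a0 a1 a2 a3 b0 b1 b2 b3 :: "'a::{idom, ring_char_0}"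
  assumes "\<And>x y. a0 * x ^ 3 + a1 * x ^ 2 * y + a2 * x * y ^ 2 + a3 * y ^ 3
             = b0 * x ^ 3 + b1 * x ^ 2 * y + b2 * x * y ^ 2 + b3 * y ^ 3"
  shows "a0 = b0 \<and> a1 = b1 \<and> a2 = b2 \<and> a3 = b3"
proof -
  have 0: "a0 = b0" using assms[of 1 0] by simp
  have 3: "a3 = b3" using assms[of 0 1] by simp
  have p: "a1 + a2 = b1 + b2" using assms[of 1 1] 0 3 by (simp add: algebra_simps)
  have m: "a2 - a1 = b2 - b1"
    using assms[of 1 "-1"] 0 3 by (simp add: algebra_simps)
  have "2 * a2 = (a1 + a2) + (a2 - a1)" by simp
  also have "\<dots> = 2 * b2" unfolding p m by simp
  finally have "a2 = b2" by simp
  with p 0 3 show ?thesis by simp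
qed

lemma form_eval_inject:
  "(\<forall>x y :: 'a::{idom, ring_char_0}. form_eval F x y = form_eval G x y) \<longleftrightarrow> F = G"
proof
  assume "\<forall>x y :: 'a. form_eval F x y = form_eval G x y"
  then have "of_int (cf0 F) = (of_int (cf0 G) :: 'a) \<and> of_int (cf1 F) = (of_int (cf1 G) :: 'a)
    \<and> of_int (cf2 F) = (of_int (cf2 G) :: 'a) \<and> of_int (cf3 F) = (of_int (cf3 G) :: 'a)"
    by (intro cubic_polynomial_coeffs_eqI) (simp add: form_eval_def)
  then show "F = G" by (intro cubic.expand) simp
qed simp


section \<open>The discriminant\<close>

text \<open>Defined through a factorization into complex linear forms; \<open>disc_eq\<close> below shows that
  a factorization exists, and that the product is an integer independent of its choice.\<close>

definition linear_factorization :: "cubic \<Rightarrow> (nat \<Rightarrow> complex) \<Rightarrow> (nat \<Rightarrow> complex) \<Rightarrow> bool" where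
  "linear_factorization F \<alpha> \<beta> \<longleftrightarrow>
     (\<forall>x y :: complex. form_eval F x y = (\<Prod>i<3. \<alpha> i * x - \<beta> i * y))"

definition disc :: "cubic \<Rightarrow> int" where
  "disc F = (THE D. \<exists>\<alpha> \<beta>. linear_factorization F \<alpha> \<beta> \<and>
     of_int D = (\<Prod>j<3. \<Prod>i<j. (\<alpha> i * \<beta> j - \<alpha> j * \<beta> i) ^ 2))"

lemma linear_factorization_exists: "\<exists>\<alpha> \<beta>. linear_factorization F \<alpha> \<beta>"
proof -
  have root: "\<exists>z :: complex. poly p z = 0" if "degree p > 0" for p :: "complex poly"
    by (rule alg_closed_imp_poly_has_root[OF that])
  define a b c d :: complex
    where "a = of_int (cf0 F)" "b = of_int (cf1 F)" "c = of_int (cf2 F)" "d = of_int (cf3 F)"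
  have quad: "\<exists>p q r s. \<forall>x y. A * x ^ 2 + B * x * y + C * y ^ 2 = (p * x - q * y) * (r * x - s * y)"
    for A B C :: complex
  proof (cases "A = 0")
    case True
    then show ?thesis
      by (intro exI[of _ 0] exI[of _ "-1"] exI[of _ B] exI[of _ "-C"])
        (simp add: algebra_simps power2_eq_square)
  next
    case False
    then obtain z where z: "poly [:C, B, A:] z = 0" using root[of "[:C, B, A:]"] by auto
    then have C: "C = - (z * (B + z * A))" by (simp add: eq_neg_iff_add_eq_0)
    show ?thesis
      by (intro exI[of _ 1] exI[of _ z] exI[of _ A] exI[of _ "- (B + z * A)"])
        (simp add: C algebra_simps power2_eq_square)
  qed
  have "\<exists>l m A B C. \<forall>x y. a * x ^ 3 + b * x ^ 2 * y + c * x * y ^ 2 + d * y ^ 3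
      = (l * x - m * y) * (A * x ^ 2 + B * x * y + C * y ^ 2)"
  proof (cases "a = 0")
    case True
    then show ?thesis
      by (intro exI[of _ 0] exI[of _ "-1"] exI[of _ b] exI[of _ c] exI[of _ d])
        (simp add: algebra_simps power2_eq_square power3_eq_cube)
  next
    case False
    then obtain z where z: "poly [:d, c, b, a:] z = 0" using root[of "[:d, c, b, a:]"] by auto
    then have d: "d = - (z * (c + z * (b + z * a)))" by (simp add: eq_neg_iff_add_eq_0)
    show ?thesis
      by (intro exI[of _ 1] exI[of _ z] exI[of _ a] exI[of _ "b + z * a"]
          exI[of _ "c + z * (b + z * a)"])
        (simp add: d algebra_simps power2_eq_square power3_eq_cube)
  qed
  then obtain l m A B C where 1: "\<And>x y. a * x ^ 3 + b * x ^ 2 * y + c * x * y ^ 2 + d * y ^ 3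
      = (l * x - m * y) * (A * x ^ 2 + B * x * y + C * y ^ 2)" by blast
  obtain p q r s where 2: "\<And>x y. A * x ^ 2 + B * x * y + C * y ^ 2
      = (p * x - q * y) * (r * x - s * y)" using quad[of A B C] by blast
  have "linear_factorization F (\<lambda>i. if i = 0 then l else if i = 1 then p else r)
      (\<lambda>i. if i = 0 then m else if i = 1 then q else s)"
    using 1 2 by (simp add: linear_factorization_def form_eval_def a_b_c_d_def
        numeral_3_eq_3 mult.assoc)
  then show ?thesis by blast
qed

lemma linear_factorization_disc:
  assumes "linear_factorization F \<alpha> \<beta>"
  shows "(\<Prod>j<3. \<Prod>i<j. (\<alpha> i * \<beta> j - \<alpha> j * \<beta> i) ^ 2) = (of_int
    (cf1 F ^ 2 * cf2 F ^ 2 - 4 * cf0 F * cf2 F ^ 3 - 4 * cf1 F ^ 3 * cf3 F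
      + 18 * cf0 F * cf1 F * cf2 F * cf3 F - 27 * cf0 F ^ 2 * cf3 F ^ 2) :: complex)"
proof -
  define a b c p q r where v: "a = \<alpha> 0" "b = \<alpha> 1" "c = \<alpha> 2" "p = \<beta> 0" "q = \<beta> 1" "r = \<beta> 2"
  have lhs: "(\<Prod>j<3. \<Prod>i<j. (\<alpha> i * \<beta> j - \<alpha> j * \<beta> i) ^ 2)
      = ((a * q - b * p) * (a * r - c * p) * (b * r - c * q)) ^ 2"
    by (simp add: v numeral_3_eq_3 numeral_2_eq_2 power_mult_distrib mult.assoc)
  have "form_eval F x y = (a * x - p * y) * (b * x - q * y) * (c * x - r * y)" for x y :: complex
    using assms by (simp add: linear_factorization_def v numeral_3_eq_3 numeral_2_eq_2 mult.assoc)
  then have "of_int (cf0 F) = a * b * c \<and> of_int (cf1 F) = - (a * b * r + a * c * q + b * c * p)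
      \<and> of_int (cf2 F) = a * q * r + b * p * r + c * p * q \<and> of_int (cf3 F) = - (p * q * r)"
    by (intro cubic_polynomial_coeffs_eqI)
      (simp add: form_eval_def algebra_simps power2_eq_square power3_eq_cube)
  then have e: "of_int (cf0 F) = a * b * c" "of_int (cf1 F) = - (a * b * r + a * c * q + b * c * p)"
      "of_int (cf2 F) = a * q * r + b * p * r + c * p * q" "of_int (cf3 F) = - (p * q * r)"
    by blast+
  show ?thesis
    unfolding lhs of_int_add of_int_diff of_int_mult of_int_power of_int_numeral e
    by Groebner_Basis.algebra
qed

lemma disc_eq:
  "disc F = cf1 F ^ 2 * cf2 F ^ 2 - 4 * cf0 F * cf2 F ^ 3 - 4 * cf1 F ^ 3 * cf3 F
      + 18 * cf0 F * cf1 F * cf2 F * cf3 F - 27 * cf0 F ^ 2 * cf3 F ^ 2"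
  (is "_ = ?D F")
proof -
  obtain \<alpha> \<beta> where fac: "linear_factorization F \<alpha> \<beta>"
    using linear_factorization_exists by blast
  show ?thesis
    unfolding disc_def
  proof (rule the_equality)
    show "\<exists>\<alpha> \<beta>. linear_factorization F \<alpha> \<beta> \<and> of_int (?D F)
        = (\<Prod>j<3. \<Prod>i<j. (\<alpha> i * \<beta> j - \<alpha> j * \<beta> i) ^ 2)"
      by (intro exI conjI) (rule fac, rule linear_factorization_disc[OF fac, symmetric])
  next
    fix E
    assume "\<exists>\<alpha> \<beta>. linear_factorization F \<alpha> \<beta> \<and> of_int E
        = (\<Prod>j<3. \<Prod>i<j. (\<alpha> i * \<beta> j - \<alpha> j * \<beta> i) ^ 2)"
    then have "(of_int E :: complex) = of_int (?D F)"
      by (elim exE conjE) (simp only: linear_factorization_disc)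
    then show "E = ?D F" by (simp only: of_int_eq_iff)
  qed
qed


section \<open>Substitutions, equivalence and maximality\<close>

text \<open>The form $F^A(x,y) = F(ax+by, cx+dy)$, written out in coefficients; see \<open>form_eval_subst\<close>.\<close>

definition form_subst :: "cubic \<Rightarrow> int ^ 2 ^ 2 \<Rightarrow> cubic" where
  "form_subst F A =
    (let a = A $ 1 $ 1; b = A $ 1 $ 2; c = A $ 2 $ 1; d = A $ 2 $ 2 in
     Cubic
      (form_eval F a c)
      (3 * cf0 F * a ^ 2 * b + cf1 F * (a ^ 2 * d + 2 * a * b * c)
        + cf2 F * (2 * a * c * d + b * c ^ 2) + 3 * cf3 F * c ^ 2 * d)
      (3 * cf0 F * a * b ^ 2 + cf1 F * (2 * a * b * d + b ^ 2 * c)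
        + cf2 F * (a * d ^ 2 + 2 * b * c * d) + 3 * cf3 F * c * d ^ 2)
      (form_eval F b d))"

lemma form_eval_subst:
  "form_eval (form_subst F A) x y =
     form_eval F (of_int (A $ 1 $ 1) * x + of_int (A $ 1 $ 2) * y)
                 (of_int (A $ 2 $ 1) * x + of_int (A $ 2 $ 2) * y)"
  by (simp add: form_subst_def form_eval_def Let_def algebra_simps power2_eq_square power3_eq_cube)

lemma form_subst_eq_iff:
  "G = form_subst F A \<longleftrightarrow> (\<forall>x y :: int. form_eval G x y =
     form_eval F (A $ 1 $ 1 * x + A $ 1 $ 2 * y) (A $ 2 $ 1 * x + A $ 2 $ 2 * y))"
  unfolding form_eval_inject[where 'a = int, symmetric] form_eval_subst by simp

text \<open>\<^term>\<open>invertible A\<close> for an integer matrix means that it has an integer inverse, i.e. that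
  it lies in $\mathrm{GL}_2(\mathbb{Z})$.\<close>

definition GL2Z_equiv :: "(cubic \<times> cubic) set" where
  "GL2Z_equiv = {(F, G). \<exists>A :: int ^ 2 ^ 2. invertible A \<and> G = form_subst F A}"

lemma form_subst_mult: "form_subst (form_subst F A) B = form_subst F (A ** B)"
  unfolding form_eval_inject[where 'a = int, symmetric] form_eval_subst
  by (simp add: matrix_matrix_mult_def sum_2 algebra_simps)

lemma form_subst_one: "form_subst F (mat 1) = F"
  unfolding form_eval_inject[where 'a = int, symmetric] form_eval_subst
  by (simp add: mat_def)

lemma equiv_GL2Z_equiv: "equiv UNIV GL2Z_equiv"
proof (rule equivI)
  show "GL2Z_equiv \<subseteq> UNIV \<times> UNIV" by simp
  have "invertible (mat 1 :: int ^ 2 ^ 2)"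
    unfolding invertible_def by (intro exI[of _ "mat 1"]) simp
  then show "refl_on UNIV GL2Z_equiv"
    unfolding refl_on_def GL2Z_equiv_def by (auto, metis form_subst_one)
  show "sym GL2Z_equiv"
  proof (rule symI)
    fix F G assume "(F, G) \<in> GL2Z_equiv"
    then obtain A B :: "int ^ 2 ^ 2"
      where "G = form_subst F A" "A ** B = mat 1" "B ** A = mat 1"
      by (auto simp: GL2Z_equiv_def invertible_def)
    then have "F = form_subst G B" "invertible B"
      by (auto simp: form_subst_mult form_subst_one invertible_def)
    then show "(G, F) \<in> GL2Z_equiv" by (auto simp: GL2Z_equiv_def)
  qed
  show "trans GL2Z_equiv"
  proof (rule transI)
    fix F G H assume "(F, G) \<in> GL2Z_equiv" "(G, H) \<in> GL2Z_equiv"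
    then obtain A B :: "int ^ 2 ^ 2"
      where "G = form_subst F A" "H = form_subst G B" "invertible A" "invertible B"
      by (auto simp: GL2Z_equiv_def)
    then have "H = form_subst F (A ** B)" "invertible (A ** B)"
      by (simp_all add: form_subst_mult invertible_mult)
    then show "(F, H) \<in> GL2Z_equiv" by (auto simp: GL2Z_equiv_def)
  qed
qed

definition proper_subform :: "cubic \<Rightarrow> cubic \<Rightarrow> bool" where
  "proper_subform G F \<longleftrightarrow> (\<exists>A :: int ^ 2 ^ 2. \<bar>det A\<bar> > 1 \<and> G = form_subst F A)"

definition maximal_form :: "cubic \<Rightarrow> bool" where
  "maximal_form F \<longleftrightarrow> (\<nexists>G. proper_subform F G)"


section \<open>The ring of $p$-adic integers\<close>

text \<open>\<open>padic_int p\<close> is the inverse limit of the rings $\mathbb{Z}/p^k$, realized as the ring of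
  compatible sequences of least nonnegative residues.\<close>

definition padic_int :: "nat \<Rightarrow> (nat \<Rightarrow> int) ring" where
  "padic_int p = \<lparr>
     carrier = {x. \<forall>k. x k \<in> {0..<int p ^ k} \<and> x (Suc k) mod int p ^ k = x k},
     monoid.mult = (\<lambda>x y k. x k * y k mod int p ^ k),
     one = (\<lambda>k. 1 mod int p ^ k),
     zero = (\<lambda>k. 0),
     add = (\<lambda>x y k. (x k + y k) mod int p ^ k)\<rparr>"

lemma padic_int_simps:
  "x \<in> carrier (padic_int p) \<longleftrightarrow>
     (\<forall>k. 0 \<le> x k \<and> x k < int p ^ k \<and> x (Suc k) mod int p ^ k = x k)"
  "(x \<otimes>\<^bsub>padic_int p\<^esub> y) k = x k * y k mod int p ^ k"
  "\<one>\<^bsub>padic_int p\<^esub> k = 1 mod int p ^ k"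
  "\<zero>\<^bsub>padic_int p\<^esub> k = 0"
  "(x \<oplus>\<^bsub>padic_int p\<^esub> y) k = (x k + y k) mod int p ^ k"
  by (simp_all add: padic_int_def)

lemma padic_int_reduceI:
  assumes "p > 0" and "\<And>k. [f (Suc k) = f k] (mod (int p ^ k))"
  shows "(\<lambda>k. f k mod int p ^ k) \<in> carrier (padic_int p)"
proof -
  have "f (Suc k) mod int p ^ Suc k mod int p ^ k = f k mod int p ^ k" for k
    using assms(2)[of k] by (simp add: mod_mod_cancel cong_def)
  then show ?thesis using assms(1) by (simp add: padic_int_simps)
qed

lemma padic_int_cong:
  assumes "x \<in> carrier (padic_int p)"
  shows "[x (Suc k) = x k] (mod (int p ^ k))"
  using assms by (metis cong_def mod_mod_trivial padic_int_simps(1))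

lemma padic_int_mod:
  assumes "x \<in> carrier (padic_int p)"
  shows "x k mod int p ^ k = x k"
  using assms by (simp add: padic_int_simps)

lemma cring_padic_int:
  assumes "p > 0"
  shows "cring (padic_int p)"
proof (intro cringI abelian_groupI comm_monoidI)
  let ?R = "padic_int p"
  have op: "(x \<otimes>\<^bsub>?R\<^esub> y) = (\<lambda>k. x k * y k mod int p ^ k)"
    "(x \<oplus>\<^bsub>?R\<^esub> y) = (\<lambda>k. (x k + y k) mod int p ^ k)"
    "\<one>\<^bsub>?R\<^esub> = (\<lambda>k. 1 mod int p ^ k)" "\<zero>\<^bsub>?R\<^esub> = (\<lambda>k. 0 mod int p ^ k)" for x y
    by (simp_all add: padic_int_def)
  show "x \<otimes>\<^bsub>?R\<^esub> y \<in> carrier ?R" if "x \<in> carrier ?R" "y \<in> carrier ?R" for x y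
    unfolding op
    by (rule padic_int_reduceI[OF assms], intro cong_mult)
      (rule padic_int_cong[OF that(1)], rule padic_int_cong[OF that(2)])
  show "x \<oplus>\<^bsub>?R\<^esub> y \<in> carrier ?R" if "x \<in> carrier ?R" "y \<in> carrier ?R" for x y
    unfolding op
    by (rule padic_int_reduceI[OF assms], intro cong_add)
      (rule padic_int_cong[OF that(1)], rule padic_int_cong[OF that(2)])
  show "\<one>\<^bsub>?R\<^esub> \<in> carrier ?R" "\<zero>\<^bsub>?R\<^esub> \<in> carrier ?R"
    unfolding op by (rule padic_int_reduceI[OF assms], simp)+
  show "\<exists>y\<in>carrier ?R. y \<oplus>\<^bsub>?R\<^esub> x = \<zero>\<^bsub>?R\<^esub>" if "x \<in> carrier ?R" for x
  proof
    show "(\<lambda>k. (- x k) mod int p ^ k) \<in> carrier ?R"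
      by (rule padic_int_reduceI[OF assms]) (simp add: cong_minus_minus_iff padic_int_cong[OF that])
    show "(\<lambda>k. (- x k) mod int p ^ k) \<oplus>\<^bsub>?R\<^esub> x = \<zero>\<^bsub>?R\<^esub>"
      by (simp add: op mod_simps)
  qed
qed (auto simp: fun_eq_iff padic_int_simps mod_simps algebra_simps)

definition form_eval_ring :: "('a, 'b) ring_scheme \<Rightarrow> cubic \<Rightarrow> 'a \<Rightarrow> 'a \<Rightarrow> 'a" where
  "form_eval_ring R F x y =
     [cf0 F] \<cdot>\<^bsub>R\<^esub> (x [^]\<^bsub>R\<^esub> (3::nat))
     \<oplus>\<^bsub>R\<^esub> [cf1 F] \<cdot>\<^bsub>R\<^esub> (x [^]\<^bsub>R\<^esub> (2::nat) \<otimes>\<^bsub>R\<^esub> y)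
     \<oplus>\<^bsub>R\<^esub> [cf2 F] \<cdot>\<^bsub>R\<^esub> (x \<otimes>\<^bsub>R\<^esub> y [^]\<^bsub>R\<^esub> (2::nat))
     \<oplus>\<^bsub>R\<^esub> [cf3 F] \<cdot>\<^bsub>R\<^esub> (y [^]\<^bsub>R\<^esub> (3::nat))"

lemma padic_int_add_pow:
  assumes "p > 0" "x \<in> carrier (padic_int p)"
  shows "([(n::int)] \<cdot>\<^bsub>padic_int p\<^esub> x) k = n * x k mod int p ^ k"
proof -
  interpret cring "padic_int p" by (rule cring_padic_int[OF assms(1)])
  have nat: "([m] \<cdot>\<^bsub>padic_int p\<^esub> x) k = int m * x k mod int p ^ k" for m :: nat
    by (induction m) (simp_all add: padic_int_simps mod_simps algebra_simps)
  show ?thesis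
  proof (cases "n \<ge> 0")
    case True
    then show ?thesis using nat[of "nat n"] by (simp add: add_pow_int_ge)
  next
    case False
    define y where "y = [nat (- n)] \<cdot>\<^bsub>padic_int p\<^esub> x"
    have y: "y \<in> carrier (padic_int p)" using assms(2) by (simp add: y_def)
    define z where "z = \<ominus>\<^bsub>padic_int p\<^esub> y"
    have z: "z \<in> carrier (padic_int p)" using y by (simp add: z_def)
    have "(z \<oplus>\<^bsub>padic_int p\<^esub> y) k = 0" using y by (simp add: z_def l_neg padic_int_simps)
    then have "[z k = - y k] (mod (int p ^ k))"
      by (simp add: padic_int_simps cong_iff_dvd_diff mod_0_imp_dvd)
    then have "z k = (- y k) mod int p ^ k" using padic_int_mod[OF z, of k] by (simp add: cong_def)
    also have "\<dots> = n * x k mod int p ^ k"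
      using False by (simp add: y_def nat mod_simps)
    finally show ?thesis using False by (simp add: add_pow_int_lt z_def y_def)
  qed
qed

lemma form_eval_padic_int:
  assumes "p > 0" "x \<in> carrier (padic_int p)" "y \<in> carrier (padic_int p)"
  shows "form_eval_ring (padic_int p) F x y k = form_eval F (x k) (y k) mod int p ^ k"
proof -
  interpret cring "padic_int p" by (rule cring_padic_int[OF assms(1)])
  have pow: "(u [^]\<^bsub>padic_int p\<^esub> (n::nat)) k = u k ^ n mod int p ^ k" for u n
    by (induction n) (simp_all add: padic_int_simps mod_simps algebra_simps)
  show ?thesis
    using assms
    by (simp add: form_eval_ring_def form_eval_def padic_int_add_pow padic_int_simps(2,5) pow
        mod_simps mult.assoc)
qed


section \<open>Representing an integer, and counting classes\<close>

definition locally_represents :: "cubic \<Rightarrow> int \<Rightarrow> bool" where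
  "locally_represents F h \<longleftrightarrow>
     (\<exists>x y :: real. form_eval F x y = of_int h) \<and>
     (\<forall>p :: nat. prime p \<longrightarrow>
        (\<exists>x \<in> carrier (padic_int p). \<exists>y \<in> carrier (padic_int p).
           form_eval_ring (padic_int p) F x y = [h] \<cdot>\<^bsub>padic_int p\<^esub> \<one>\<^bsub>padic_int p\<^esub>))"

definition globally_represents :: "cubic \<Rightarrow> int \<Rightarrow> bool" where
  "globally_represents F h \<longleftrightarrow> (\<exists>x y :: int. form_eval F x y = h)"

text \<open>There are only finitely many classes of each nonzero discriminant, so the cardinalities below
  are cardinalities of finite sets.\<close>

definition cubic_classes :: "real \<Rightarrow> cubic set set" where
  "cubic_classes X = {C \<in> UNIV // GL2Z_equiv.
     \<forall>F \<in> C. disc F \<noteq> 0 \<and> real_of_int \<bar>disc F\<bar> < X}"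

definition N3 :: "real \<Rightarrow> nat" where
  "N3 X = card (cubic_classes X)"

definition N3_h :: "int \<Rightarrow> real \<Rightarrow> nat" where
  "N3_h h X = card {C \<in> cubic_classes X.
     \<forall>F \<in> C. locally_represents F h \<and> \<not> globally_represents F h \<and> maximal_form F}"

end

theory Submission
  imports Defs "HOL-Number_Theory.Number_Theory"
begin

text \<open>The classes are ordered by discriminant, so reducible forms already have positive proportion,
  and for them the Hasse principle fails for a trivial reason. Put $b = 210|h|$ and
  $F_d = y(bx^2 + xy + dy^2)$ with $d > |h|$. The quadratic factor is positive definite and exceeds
  $|h|$ at all integer points with $y \neq 0$, so $F_d$ does not represent $h$. It represents $h$
  over $\mathbb{Z}_p$ for $p \mid b$ by Hensel's lemma at $y = 1$, and for $p \nmid b$ (so that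
  $p \geq 11$) because an evaluation of power sums finds a solution modulo $p$. It is maximal because
  the coefficients $b$ and $1 - 3bd$ of its Hessian are coprime. Distinct $d$ give distinct
  discriminants, so there are $\gg X$ such classes.

  That there are $O(X)$ classes altogether follows from reduction theory. Write $X = L^4$. Reducing
  the Hessian (positive discriminant) or the definite quadratic factor (negative discriminant) leads
  to a representative with $a = O(L)$ and $P = b^2 - 3ac = O(L^2)$, where moreover $0 \leq b < 3a$
  if $a > 0$. Given $a$, $b$, $c$, the number of admissible $d$ is bounded by means of the syzygy
  $4P^3 = U^2 + 27 \mathrm{disc}(F) a^2$, in which $U$ is linear in $d$.\<close>

section \<open>Power sums modulo a prime\<close>

text \<open>As an equation in x, F_d(x,y) = h is quadratic. Modulo a prime p not dividing b it asks
  for a point with y a unit on the curve w^2 = (1 - 4bd) y^4 + 4bhy, in general of genus one. Power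
  sums stand in for the Hasse bound; they need a multiple of 3 strictly between (p-1)/2 and p-1,
  which p = 7 does not offer and every p >= 11 does. The factor 210 therefore moves 2, 3, 5, 7 into
  b. The factor |h| makes h a unit at the remaining primes, so that every solution modulo p is a
  smooth point and lifts. The coefficient 1 of xy^2 makes the form x + d at y = 1 modulo the primes
  of b, and it keeps the Hessian primitive.

  For the upper bound the obstacle is large c. Summed over all a, b, c with P = O(L^2), the estimate
  |U| <= (4|P|^3 + 27 a^2 X)^(1/2) alone gives only O(L^5). Where |P| is large, U is confined to
  short intervals around 2|P|^(3/2) and its negative (around 0 if P < 0), which saves the factor
  L.\<close>

lemma sum_power_cong_0:
  fixes p e :: nat
  assumes p: "prime p" and e: "\<not> (p - 1) dvd e"
  shows "[(\<Sum>y\<in>{0<..<int p}. y ^ e) = 0] (mod int p)"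
proof -
  obtain g where g: "residue_primroot p g"
    using prime_primitive_root_exists[OF prime_gt_1_nat[OF p] p] by blast
  have cop: "coprime (int p) (int g)" and ord: "ord p g = p - 1"
    using g p by (auto simp: residue_primroot_def totient_prime)
  have p1: "int p > 1" using prime_gt_1_nat[OF p] by simp
  have ge: "\<not> [int g ^ e = 1] (mod int p)"
    using e ord ord_divides[of g e p] by (metis cong_int_iff of_nat_1 of_nat_power)
  let ?f = "\<lambda>y. int g * y mod int p"
  let ?A = "{0<..<int p}"
  have fA: "?f y \<in> ?A" if "y \<in> ?A" for y
  proof -
    have "\<not> int p dvd int g * y"
      using that cop coprime_dvd_mult_right_iff[OF cop, of y] zdvd_not_zless[of y "int p"] by auto
    then have "?f y \<noteq> 0" by (simp add: mod_eq_0_iff_dvd)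
    moreover have "?f y \<ge> 0" "?f y < int p" using p1 by simp_all
    ultimately show ?thesis by simp
  qed
  have inj: "inj_on ?f ?A"
  proof (rule inj_onI)
    fix x y assume xy: "x \<in> ?A" "y \<in> ?A" "?f x = ?f y"
    then have "[int g * x = int g * y] (mod int p)" by (simp add: cong_def)
    then have "[x = y] (mod int p)"
      using cop cong_mult_lcancel coprime_commute by blast
    then show "x = y" using xy by (simp add: cong_def)
  qed
  have img: "?f ` ?A = ?A"
    by (rule card_subset_eq) (use fA in \<open>auto simp: card_image[OF inj]\<close>)
  \<comment> \<open>Multiplication by the primitive root \<open>g\<close> permutes the units, so
    \<open>?S\<close> is congruent to \<open>g ^ e * ?S\<close>, while \<open>g ^ e\<close> is not 1
    modulo \<open>p\<close>.\<close>
  let ?S = "\<Sum>y\<in>?A. y ^ e"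
  have "?S = (\<Sum>y\<in>?A. ?f y ^ e)"
    using sum.reindex[OF inj, of "\<lambda>y. y ^ e"] img by simp
  moreover have "[(\<Sum>y\<in>?A. ?f y ^ e) = (\<Sum>y\<in>?A. int g ^ e * y ^ e)] (mod int p)"
    by (intro cong_sum) (simp add: cong_def power_mod flip: power_mult_distrib)
  ultimately have "[?S = int g ^ e * ?S] (mod int p)"
    by (metis sum_distrib_left)
  then have "int p dvd ?S * (int g ^ e - 1)"
    by (simp add: cong_iff_dvd_diff algebra_simps dvd_diff_commute)
  moreover have "prime (int p)" using p by simp
  moreover have "\<not> int p dvd int g ^ e - 1" using ge by (simp add: cong_iff_dvd_diff)
  ultimately show ?thesis using prime_dvd_mult_iff[of "int p"] by (simp add: cong_0_iff)
qed

lemma sum_power_cong_minus_1: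
  fixes p e :: nat
  assumes p: "prime p" and e: "(p - 1) dvd e"
  shows "[(\<Sum>y\<in>{0<..<int p}. y ^ e) = -1] (mod int p)"
proof -
  have p1: "int p > 1" using prime_gt_1_nat[OF p] by simp
  have "[y ^ e = 1] (mod int p)" if y: "y \<in> {0<..<int p}" for y
  proof -
    obtain c where c: "e = (p - 1) * c" using e by auto
    have "\<not> p dvd nat y" using y by (auto dest!: dvd_imp_le)
    then have "[nat y ^ (p - 1) = 1] (mod p)" using fermat_theorem p by blast
    then have "[y ^ (p - 1) = 1] (mod int p)" using y
      by (metis cong_int_iff greaterThanLessThan_iff int_nat_eq int_ops(2) of_nat_power order_less_imp_le)
    then have "[(y ^ (p - 1)) ^ c = 1 ^ c] (mod int p)" by (rule cong_pow)
    then show ?thesis by (simp add: c power_mult)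
  qed
  then have "[(\<Sum>y\<in>{0<..<int p}. y ^ e) = (\<Sum>y\<in>{0<..<int p}. 1)] (mod int p)"
    by (intro cong_sum)
  also have "(\<Sum>y\<in>{0<..<int p}. 1) = int p - 1" using p1 by simp
  also have "[int p - 1 = -1] (mod int p)" by (simp add: cong_iff_dvd_diff)
  finally show ?thesis .
qed

text \<open>Otherwise $f(y)^n \equiv -1$ for all units $y$, where $f(y) = \Delta y^4 + k y$ and
  $2n = p - 1$. Then $\sum_y y^{3i} f(y)^n \equiv -\sum_y y^{3i} \equiv 0$ for $0 < 3i < 2n$,
  whereas for $n < 3i$ the expansion of the left-hand side has exactly one nonzero power sum.\<close>

lemma quartic_is_square_mod_prime:
  fixes p :: nat and k \<Delta> :: int
  assumes p: "prime p" "p \<ge> 11" and k: "\<not> int p dvd k"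
  shows "\<exists>y w. \<not> int p dvd y \<and> [\<Delta> * y ^ 4 + k * y = w ^ 2] (mod int p)"
proof (cases "int p dvd \<Delta>")
  case True
  \<comment> \<open>The point \<open>y = k\<close>, \<open>w = k\<close>: modulo \<open>p\<close>
    only the term \<open>k * y\<close> survives.\<close>
  then have "[\<Delta> * k ^ 4 + k * k = k ^ 2] (mod int p)"
    by (simp add: cong_iff_dvd_diff power2_eq_square)
  with k show ?thesis by blast
next
  case False
  have pr: "prime (int p)" using p by simp
  define n where "n = (p - 1) div 2"
  \<comment> \<open>The least \<open>i\<close> with \<open>3 * i > n\<close>. It satisfies
    \<open>3 * i < 2 * n\<close> here, whereas \<open>p = 7\<close>, that is \<open>n = 3\<close>,
    would give \<open>3 * i = 2 * n\<close>.\<close>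
  define i where "i = n div 3 + 1"
  have "odd p" using prime_odd_nat[OF p(1)] p(2) by simp
  then have n2: "p - 1 = 2 * n" unfolding n_def by simp
  have n5: "n \<ge> 5" using p(2) n_def by simp
  have i: "n < 3 * i" "3 * i < 2 * n" "i \<le> n" "i > 0" using n5 by (auto simp: i_def)
  let ?f = "\<lambda>y::int. \<Delta> * y ^ 4 + k * y"
  let ?A = "{0<..<int p}"
  show ?thesis
  proof (rule ccontr)
    assume *: "\<nexists>y w. \<not> int p dvd y \<and> [?f y = w ^ 2] (mod int p)"
    have f: "[?f y ^ n = -1] (mod int p)" if y: "y \<in> ?A" for y
    proof -
      have y': "\<not> int p dvd y" using y by (auto dest!: zdvd_imp_le)
      have "\<not> QuadRes (int p) (?f y)" using * y' unfolding QuadRes_def by (metis cong_sym)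
      moreover have "\<not> [?f y = 0] (mod int p)" using * y' by (metis zero_power2)
      ultimately have "Legendre (?f y) (int p) = -1" by (simp add: Legendre_def)
      then show ?thesis using euler_criterion[of p "?f y"] p n_def
        by (simp add: cong_sym)
    qed
    have "[(\<Sum>y\<in>?A. y ^ (3*i) * ?f y ^ n) = (\<Sum>y\<in>?A. y ^ (3*i) * -1)] (mod int p)"
      by (intro cong_sum cong_mult cong_refl f)
    also have "(\<Sum>y\<in>?A. y ^ (3*i) * -1) = - (\<Sum>y\<in>?A. y ^ (3*i))"
      by (simp add: sum_negf)
    also have "[\<dots> = - 0] (mod int p)"
      unfolding cong_minus_minus_iff
      by (rule sum_power_cong_0[OF p(1)]) (use i n2 in \<open>auto dest!: dvd_imp_le\<close>)
    finally have S0: "[(\<Sum>y\<in>?A. y ^ (3*i) * ?f y ^ n) = 0] (mod int p)" by simp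
    define c where "c = (\<lambda>j. of_nat (n choose j) * \<Delta> ^ j * k ^ (n - j))"
    \<comment> \<open>The exponent \<open>3 * i + 4 * j + (n - j)\<close> of the \<open>j\<close>-th
      binomial term. For \<open>j \<le> n\<close> it lies strictly between \<open>2 * n\<close> and
      \<open>6 * n\<close>, so the only multiple of \<open>p - 1 = 2 * n\<close> it can be is
      \<open>4 * n\<close>, at \<open>j = n - i\<close>.\<close>
    define e where "e = (\<lambda>j. 3 * i + n + 3 * j)"
    have "y ^ (3*i) * ?f y ^ n = (\<Sum>j\<le>n. c j * y ^ e j)" for y
      unfolding binomial_ring sum_distrib_left
    proof (intro sum.cong refl)
      fix j assume "j \<in> {..n}"
      then obtain m where m: "n = j + m" by (auto simp: le_iff_add)
      show "y ^ (3*i) * (of_nat (n choose j) * (\<Delta> * y ^ 4) ^ j * (k * y) ^ (n - j)) = c j * y ^ e j"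
      proof -
        have "e j = 3 * i + 4 * j + m" by (simp add: e_def m)
        then have "y ^ e j = y ^ (3*i) * (y ^ 4) ^ j * y ^ m" by (simp add: power_add power_mult)
        then show ?thesis by (simp add: m c_def power_mult_distrib mult_ac)
      qed
    qed
    then have "(\<Sum>y\<in>?A. y ^ (3*i) * ?f y ^ n) = (\<Sum>j\<le>n. c j * (\<Sum>y\<in>?A. y ^ e j))"
      by (simp add: sum_distrib_left) (rule sum.swap)
    also have "[\<dots> = (\<Sum>j\<le>n. if j = n - i then - c j else 0)] (mod int p)"
    proof (rule cong_sum)
      fix j assume j: "j \<in> {..n}"
      show "[c j * (\<Sum>y\<in>?A. y ^ e j) = (if j = n - i then - c j else 0)] (mod int p)"
      proof (cases "j = n - i")
        case True
        then have "e j = (p - 1) * 2" using i n2 by (simp add: e_def)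
        then have "(p - 1) dvd e j" by simp
        from cong_scalar_left[OF sum_power_cong_minus_1[OF p(1) this], of "c j"] True show ?thesis by simp
      next
        case F: False
        have "\<not> (p - 1) dvd e j"
        proof
          assume "(p - 1) dvd e j"
          then obtain q where q: "e j = 2 * n * q" using n2 by auto
          have "2 * n * q > 2 * n * 1" "2 * n * q < 2 * n * 3"
            using i j unfolding q[symmetric] e_def by auto
          then have "q > 1" "q < 3" using n5 by (simp_all only: mult_less_cancel1)
          then have "q = 2" by simp
          then have "3 * i + 3 * j = 3 * n" using q e_def by simp
          then show False using F by simp
        qed
        from cong_scalar_left[OF sum_power_cong_0[OF p(1) this], of "c j"] F show ?thesis by simp
      qed
    qed
    also have "(\<Sum>j\<le>n. if j = n - i then - c j else 0) = - c (n - i)"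
      by simp
    finally have "int p dvd c (n - i)"
      using S0 by (metis cong_0_iff cong_sym cong_trans dvd_minus_iff)
    then have "int p dvd of_nat (n choose (n - i))"
      using pr False k by (auto simp: c_def prime_dvd_mult_iff dest: prime_dvd_power[OF pr])
    then have "p dvd (n choose (n - i))" by simp
    moreover have "(n choose (n - i)) dvd fact n"
      using i by (metis binomial_fact_lemma diff_le_self dvd_triv_right)
    ultimately have "p dvd fact n" by (rule dvd_trans)
    then have "p \<le> n" using prime_dvd_fact_iff p by blast
    then show False using n2 n5 by simp
  qed
qed

section \<open>Local and global representation\<close>

text \<open>Newton iteration from a simple root. The coefficient \<open>A\<close> may vanish, so the
  same statement lifts \<open>x\<close>, in which the family is quadratic, and \<open>y\<close>, in
  which it is cubic.\<close>

lemma hensel_cubic: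
  fixes A B C E t0 :: int and p :: nat
  defines "g \<equiv> \<lambda>t. A * t ^ 3 + B * t ^ 2 + C * t + E"
  assumes p: "prime p" and root: "[g t0 = 0] (mod int p)"
    and deriv: "\<not> int p dvd 3 * A * t0 ^ 2 + 2 * B * t0 + C"
  shows "\<exists>t :: nat \<Rightarrow> int. \<forall>k. [t (Suc k) = t k] (mod int p ^ k) \<and> [g (t k) = 0] (mod int p ^ k)"
proof -
  let ?g' = "\<lambda>t. 3 * A * t ^ 2 + 2 * B * t + C"
  let ?P = "\<lambda>k t. [t = t0] (mod int p) \<and> [g t = 0] (mod int p ^ Suc k)"
  have step: "\<exists>t'. ?P (Suc k) t' \<and> [t' = t] (mod int p ^ Suc k)" if t: "?P k t" for k t
  proof -
    define q where "q = int p ^ Suc k"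
    obtain m where m: "g t = q * m" using t by (auto simp: q_def cong_0_iff)
    have "[?g' t = ?g' t0] (mod int p)"
      using t by (intro cong_add cong_mult cong_pow cong_refl) auto
    then have "\<not> int p dvd ?g' t" using deriv by (simp add: cong_dvd_iff)
    then have "coprime (?g' t) (int p)"
      using p by (simp add: coprime_commute prime_imp_coprime)
    then obtain v where "[?g' t * v = 1] (mod int p)"
      using cong_solve_coprime_int by blast
    then have "[?g' t * v * - m = 1 * - m] (mod int p)" by (rule cong_scalar_right)
    then have "int p dvd m + ?g' t * (v * - m)"
      by (simp add: cong_iff_dvd_diff algebra_simps)
    then obtain u where u: "int p dvd m + ?g' t * u" by blast
    have pq: "int p * q = int p ^ Suc (Suc k)" "int p dvd q" by (simp_all add: q_def)
    \<comment> \<open>Taylor expansion at \<open>t\<close>: the first bracket is divisible by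
      \<open>p\<close> by the choice of \<open>u\<close>, and the remainder carries
      \<open>q * q\<close>.\<close>
    have "g (t + q * u) = q * (m + ?g' t * u) + q * q * (u ^ 2 * (3 * A * t + B) + q * u ^ 3 * A)"
      using m unfolding g_def by (simp add: algebra_simps power2_eq_square power3_eq_cube)
    moreover have "int p * q dvd q * (m + ?g' t * u)"
      using u by (simp add: mult.commute mult_dvd_mono)
    moreover have "int p * q dvd q * q * (u ^ 2 * (3 * A * t + B) + q * u ^ 3 * A)"
      using pq(2) by (intro dvd_mult2 mult_dvd_mono) simp_all
    ultimately have "[g (t + q * u) = 0] (mod int p ^ Suc (Suc k))"
      unfolding pq(1)[symmetric] cong_0_iff by simp
    moreover have "[t + q * u = t] (mod q)" by (simp add: cong_iff_dvd_diff)
    moreover from this have "[t + q * u = t] (mod int p)"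
      using pq(2) cong_dvd_modulus by blast
    ultimately show ?thesis
      using t cong_trans unfolding q_def by blast
  qed
  have "?P 0 t0" using root by simp
  then obtain t where t: "\<And>k. ?P k (t k)" "\<And>k. [t (Suc k) = t k] (mod int p ^ Suc k)"
    using dependent_nat_choice[of ?P "\<lambda>k t t'. [t' = t] (mod int p ^ Suc k)"] step by blast
  \<comment> \<open>The sequence has accuracy \<open>p ^ Suc k\<close> at index \<open>k\<close>;
    one power is given away to match the indexing of the p-adic integers.\<close>
  have "int p ^ k dvd int p ^ Suc k" for k by simp
  then show ?thesis using t cong_dvd_modulus by blast
qed

section \<open>Solubility over the p-adic integers by compatible integer sequences\<close>

lemma form_eval_cong:
  fixes x y x' y' m :: int
  assumes "[x = x'] (mod m)" "[y = y'] (mod m)"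
  shows "[form_eval F x y = form_eval F x' y'] (mod m)"
  unfolding form_eval_def by (intro cong_add cong_mult cong_pow cong_refl assms)

text \<open>The integers need not be least residues, so solutions can be lifted and transformed
  linearly without taking remainders at every level.\<close>

definition padic_represents :: "nat \<Rightarrow> cubic \<Rightarrow> int \<Rightarrow> bool" where
  "padic_represents p F h \<longleftrightarrow> (\<exists>x y :: nat \<Rightarrow> int. \<forall>k.
     [x (Suc k) = x k] (mod int p ^ k) \<and> [y (Suc k) = y k] (mod int p ^ k) \<and>
     [form_eval F (x k) (y k) = h] (mod int p ^ k))"

lemma padic_represents_iff:
  assumes "p > 0"
  shows "(\<exists>x \<in> carrier (padic_int p). \<exists>y \<in> carrier (padic_int p).
      form_eval_ring (padic_int p) F x y = [h] \<cdot>\<^bsub>padic_int p\<^esub> \<one>\<^bsub>padic_int p\<^esub>)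
    \<longleftrightarrow> padic_represents p F h"
    (is "?L \<longleftrightarrow> _")
proof -
  interpret cring "padic_int p" by (rule cring_padic_int[OF assms])
  have h: "([h] \<cdot>\<^bsub>padic_int p\<^esub> \<one>\<^bsub>padic_int p\<^esub>) k = h mod int p ^ k" for k
    using padic_int_add_pow[OF assms one_closed] by (simp add: padic_int_simps mod_simps)
  show ?thesis
  proof
    assume ?L
    then obtain x y where xy: "x \<in> carrier (padic_int p)" "y \<in> carrier (padic_int p)"
      "form_eval_ring (padic_int p) F x y = [h] \<cdot>\<^bsub>padic_int p\<^esub> \<one>\<^bsub>padic_int p\<^esub>" by blast
    then have "[form_eval F (x k) (y k) = h] (mod int p ^ k)" for k
      unfolding cong_def by (metis h form_eval_padic_int[OF assms])
    then show "padic_represents p F h"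
      unfolding padic_represents_def
      by (intro exI[of _ x] exI[of _ y] allI conjI padic_int_cong xy)
  next
    assume "padic_represents p F h"
    then obtain x y where
      xy: "\<And>k. [x (Suc k) = x k] (mod int p ^ k)" "\<And>k. [y (Suc k) = y k] (mod int p ^ k)"
        "\<And>k. [form_eval F (x k) (y k) = h] (mod int p ^ k)"
      unfolding padic_represents_def by blast
    let ?r = "\<lambda>x k. x k mod int p ^ k"
    have car: "?r x \<in> carrier (padic_int p)" "?r y \<in> carrier (padic_int p)"
      using padic_int_reduceI[OF assms] xy by auto
    have "[form_eval F (?r x k) (?r y k) = h] (mod int p ^ k)" for k
      using form_eval_cong[of "?r x k" "x k" "int p ^ k" "?r y k" "y k" F] xy(3)[of k]
        cong_trans by simp
    then have "form_eval_ring (padic_int p) F (?r x) (?r y)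
        = [h] \<cdot>\<^bsub>padic_int p\<^esub> \<one>\<^bsub>padic_int p\<^esub>"
      by (intro ext) (simp add: form_eval_padic_int[OF assms car] h cong_def)
    then show ?L using car by blast
  qed
qed

lemma locally_represents_iff:
  "locally_represents F h \<longleftrightarrow>
     (\<exists>x y :: real. form_eval F x y = of_int h) \<and> (\<forall>p. prime p \<longrightarrow> padic_represents p F h)"
  unfolding locally_represents_def
  by (intro conj_cong all_cong1 imp_cong refl padic_represents_iff prime_gt_0_nat)

text \<open>The matrix \<open>A\<close> carries solutions for the subform to solutions for
  \<open>F\<close> at every place. Equivalent forms are subforms of each other, whence
  invariance.\<close>

lemma locally_represents_form_substD:
  assumes "locally_represents (form_subst F A) h"
  shows "locally_represents F h"
proof -
  have "padic_represents p F h" if "padic_represents p (form_subst F A) h" for p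
  proof -
    from that obtain x y where
      xy: "\<And>k. [x (Suc k) = x k] (mod int p ^ k)" "\<And>k. [y (Suc k) = y k] (mod int p ^ k)"
        "\<And>k. [form_eval (form_subst F A) (x k) (y k) = h] (mod int p ^ k)"
      unfolding padic_represents_def by blast
    show ?thesis
      unfolding padic_represents_def
    proof (intro exI allI conjI)
      fix k
      show "[A $ 1 $ 1 * x (Suc k) + A $ 1 $ 2 * y (Suc k) = A $ 1 $ 1 * x k + A $ 1 $ 2 * y k]
          (mod int p ^ k)"
        "[A $ 2 $ 1 * x (Suc k) + A $ 2 $ 2 * y (Suc k) = A $ 2 $ 1 * x k + A $ 2 $ 2 * y k]
          (mod int p ^ k)"
        by (intro cong_add cong_scalar_left xy)+
      show "[form_eval F (A $ 1 $ 1 * x k + A $ 1 $ 2 * y k) (A $ 2 $ 1 * x k + A $ 2 $ 2 * y k) = h]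
          (mod int p ^ k)"
        using xy(3)[of k] unfolding form_eval_subst by simp
    qed
  qed
  moreover have "\<exists>x y :: real. form_eval F x y = of_int h"
    using assms unfolding locally_represents_iff form_eval_subst by blast
  ultimately show ?thesis using assms unfolding locally_represents_iff by blast
qed

lemma globally_represents_form_substD:
  "globally_represents (form_subst F A) h \<Longrightarrow> globally_represents F h"
  unfolding globally_represents_def form_eval_subst by blast

text \<open>Completing the square gives
  \<open>4 b y (F - h) = (2 b y x + y^2)^2 - (\<Delta> y^4 + 4 b h y)\<close> with
  \<open>\<Delta> = 1 - 4 b d\<close>. Over the reals and modulo primes not dividing
  \<open>b\<close> it suffices that the last bracket is a square for some invertible
  \<open>y\<close>. A residue solution is then lifted in a variable whose partial derivative is a
  unit.\<close>

lemma locally_represents_family: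
  assumes h: "h \<noteq> 0"
  shows "locally_represents (Cubic 0 (210 * \<bar>h\<bar>) 1 d) h"
proof -
  define b where "b = 210 * \<bar>h\<bar>"
  have b0: "b > 0" using h by (simp add: b_def)
  let ?F = "Cubic 0 b 1 d"
  have F: "form_eval ?F x y = b * x ^ 2 * y + x * y ^ 2 + d * y ^ 3" for x y :: int
    by (simp add: form_eval_def)
  have "\<exists>x y :: real. form_eval ?F x y = of_int h"
  proof -
    define \<Delta> :: real where "\<Delta> = 1 - 4 * of_int b * of_int d"
    \<comment> \<open>For small \<open>y\<close> of the same sign as \<open>h\<close> the linear
      term \<open>4 b h y\<close> is positive and dominates; this size ensures
      \<open>|\<Delta>| \<epsilon>^4 \<le> \<epsilon>\<close>.\<close>
    define \<epsilon> where "\<epsilon> = 1 / (1 + \<bar>\<Delta>\<bar>)"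
    define y :: real where "y = of_int (sgn h) * \<epsilon>"
    have \<epsilon>: "0 < \<epsilon>" "\<epsilon> \<le> 1" "\<bar>\<Delta>\<bar> * \<epsilon> \<le> 1" by (simp_all add: \<epsilon>_def field_simps)
    have y0: "y \<noteq> 0" using h \<epsilon> by (simp add: y_def sgn_if)
    have y4: "y ^ 4 = \<epsilon> ^ 4" "of_int h * y = \<bar>of_int h\<bar> * \<epsilon>"
      using h by (simp_all add: y_def sgn_if power_mult_distrib)
    have "\<bar>\<Delta>\<bar> * \<epsilon> ^ 4 = (\<bar>\<Delta>\<bar> * \<epsilon>) * \<epsilon> ^ 2 * \<epsilon>" by (simp add: power_numeral_reduce)
    also have "\<dots> \<le> 1 * 1 * \<epsilon>"
      using \<epsilon> by (intro mult_mono power_le_one) auto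
    finally have 1: "\<bar>\<Delta> * \<epsilon> ^ 4\<bar> \<le> \<epsilon>" by (simp add: abs_mult)
    have "real_of_int b \<ge> 1" "\<bar>real_of_int h\<bar> \<ge> 1" using b0 h by linarith+
    then have "1 * 1 * \<epsilon> \<le> 4 * of_int b * \<bar>of_int h\<bar> * \<epsilon>"
      using \<epsilon> by (intro mult_mono) auto
    then have 2: "\<Delta> * y ^ 4 + 4 * of_int b * (of_int h * y) \<ge> 0" using 1 y4 by simp
    define s where "s = sqrt (\<Delta> * y ^ 4 + 4 * of_int b * (of_int h * y))"
    have s2: "s ^ 2 = \<Delta> * y ^ 4 + 4 * of_int b * (of_int h * y)" using 2 s_def by simp
    define x where "x = (s - y ^ 2) / (2 * of_int b * y)"
    have x: "2 * of_int b * y * x = s - y ^ 2" using y0 b0 by (simp add: x_def)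
    have "4 * of_int b * y * (of_int b * x ^ 2 * y + x * y ^ 2 + of_int d * y ^ 3)
        = (2 * of_int b * y * x + y ^ 2) ^ 2 - \<Delta> * y ^ 4"
      unfolding \<Delta>_def by (simp add: algebra_simps power_numeral_reduce)
    also have "\<dots> = 4 * of_int b * y * of_int h" unfolding x using s2 by (simp add: algebra_simps)
    finally have "form_eval ?F x y = of_int h" using y0 b0 by (simp add: form_eval_def)
    then show ?thesis by blast
  qed
  moreover have "padic_represents p ?F h" if p: "prime p" for p
  proof -
    have lift_x: "padic_represents p ?F h"
      if "[form_eval ?F x0 y0 = h] (mod int p)" "\<not> int p dvd 2 * b * y0 * x0 + y0 ^ 2" for x0 y0
    proof -
      have "[0 * x0 ^ 3 + b * y0 * x0 ^ 2 + y0 ^ 2 * x0 + (d * y0 ^ 3 - h) = 0] (mod int p)"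
        "\<not> int p dvd 3 * 0 * x0 ^ 2 + 2 * (b * y0) * x0 + y0 ^ 2"
        using that by (simp_all add: F cong_iff_dvd_diff algebra_simps)
      from hensel_cubic[OF p this] obtain t where "\<forall>k. [t (Suc k) = t k] (mod int p ^ k) \<and>
        [0 * t k ^ 3 + b * y0 * t k ^ 2 + y0 ^ 2 * t k + (d * y0 ^ 3 - h) = 0] (mod int p ^ k)"
        by blast
      then show ?thesis
        unfolding padic_represents_def
        by (intro exI[of _ t] exI[of _ "\<lambda>_. y0"]) (auto simp: F cong_iff_dvd_diff algebra_simps)
    qed
    have lift_y: "padic_represents p ?F h"
      if "[form_eval ?F x0 y0 = h] (mod int p)" "\<not> int p dvd 3 * d * y0 ^ 2 + 2 * x0 * y0 + b * x0 ^ 2"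
      for x0 y0
    proof -
      have "[d * y0 ^ 3 + x0 * y0 ^ 2 + b * x0 ^ 2 * y0 + (- h) = 0] (mod int p)"
        "\<not> int p dvd 3 * d * y0 ^ 2 + 2 * x0 * y0 + b * x0 ^ 2"
        using that by (simp_all add: F cong_iff_dvd_diff algebra_simps)
      from hensel_cubic[OF p this] obtain t where "\<forall>k. [t (Suc k) = t k] (mod int p ^ k) \<and>
        [d * t k ^ 3 + x0 * t k ^ 2 + b * x0 ^ 2 * t k + (- h) = 0] (mod int p ^ k)"
        by blast
      then show ?thesis
        unfolding padic_represents_def
        by (intro exI[of _ t] exI[of _ "\<lambda>_. x0"]) (auto simp: F cong_iff_dvd_diff algebra_simps)
    qed
    have pr: "prime (int p)" using p by simp
    have p1: "\<not> int p dvd 1" using pr by auto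
    show ?thesis
    proof (cases "int p dvd b")
      case True
      \<comment> \<open>At \<open>y = 1\<close> the form is \<open>x + d\<close> modulo
        \<open>p\<close>, with derivative 1 in \<open>x\<close>; hence the starting point
        \<open>h - d\<close>.\<close>
      have "int p dvd b * (h - d) ^ 2" using True by simp
      then show ?thesis
        using lift_x[of "h - d" 1] True p1
        by (auto simp: F cong_iff_dvd_diff dvd_add_right_iff)
    next
      case False
      have "\<not> int p dvd 210" "\<not> int p dvd h" using False by (auto simp: b_def)
      then have "\<not> p dvd 210" by (metis of_nat_dvd_iff of_nat_numeral)
      have p11: "p \<ge> 11"
      proof (rule ccontr)
        assume "\<not> p \<ge> 11"
        then have "p = 0 \<or> p = 1 \<or> p = 2 \<or> p = 3 \<or> p = 4 \<or> p = 5 \<or> p = 6 \<or> p = 7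
          \<or> p = 8 \<or> p = 9 \<or> p = 10" by presburger
        then show False using p \<open>\<not> p dvd 210\<close> by (elim disjE) simp_all
      qed
      have nd: "\<not> int p dvd 2" "\<not> int p dvd 3" "\<not> int p dvd 4"
        using zdvd_imp_le[of "int p" 2] zdvd_imp_le[of "int p" 3] zdvd_imp_le[of "int p" 4] p11
        by auto
      note dvd_mult_p = prime_dvd_mult_iff[OF pr]
      have "\<not> int p dvd 4 * b * h"
        using False \<open>\<not> int p dvd h\<close> nd(3) by (metis dvd_mult_p)
      from quartic_is_square_mod_prime[OF p p11 this, of "1 - 4 * b * d"]
      obtain y w where y: "\<not> int p dvd y"
        and w: "[(1 - 4 * b * d) * y ^ 4 + 4 * b * h * y = w ^ 2] (mod int p)"
        by blast
      have "\<not> int p dvd 2 * b * y" using False y nd(1) by (metis dvd_mult_p)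
      then have "coprime (2 * b * y) (int p)"
        using prime_imp_coprime[OF pr] coprime_commute by blast
      then obtain v where "[2 * b * y * v = 1] (mod int p)"
        using cong_solve_coprime_int by blast
      then have "[2 * b * y * v * (w - y ^ 2) = 1 * (w - y ^ 2)] (mod int p)"
        by (rule cong_scalar_right)
      then have "\<exists>x. [2 * b * y * x = w - y ^ 2] (mod int p)"
        by (intro exI[of _ "v * (w - y ^ 2)"]) (simp add: mult.assoc)
      then obtain x where "[2 * b * y * x = w - y ^ 2] (mod int p)" by blast
      then have "[2 * b * y * x + y ^ 2 = w] (mod int p)"
        by (simp add: cong_iff_dvd_diff algebra_simps)
      then have "[(2 * b * y * x + y ^ 2) ^ 2 = w ^ 2] (mod int p)" by (rule cong_pow)
      then have "[(2 * b * y * x + y ^ 2) ^ 2 = (1 - 4 * b * d) * y ^ 4 + 4 * b * h * y] (mod int p)"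
        using w cong_sym cong_trans by blast
      moreover have "(2 * b * y * x + y ^ 2) ^ 2 - ((1 - 4 * b * d) * y ^ 4 + 4 * b * h * y)
          = 4 * (b * (y * (form_eval ?F x y - h)))"
        unfolding F by (simp add: algebra_simps power_numeral_reduce)
      ultimately have "int p dvd form_eval ?F x y - h"
        using nd(3) y False unfolding cong_iff_dvd_diff by (metis dvd_mult_p)
      then have sol: "[form_eval ?F x y = h] (mod int p)" by (simp add: cong_iff_dvd_diff)
      show ?thesis
      proof (cases "int p dvd 2 * b * y * x + y ^ 2")
        case F: True
        have "\<not> int p dvd 3 * d * y ^ 2 + 2 * x * y + b * x ^ 2" (is "\<not> _ dvd ?Fy")
        proof
          assume "int p dvd ?Fy"
          \<comment> \<open>Euler's identity \<open>x F\<^sub>x + y F\<^sub>y = 3 F\<close>\<close>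
          moreover have "x * (2 * b * y * x + y ^ 2) + y * ?Fy = 3 * form_eval ?F x y"
            unfolding \<open>\<And>y x. form_eval ?F x y = b * x ^ 2 * y + x * y ^ 2 + d * y ^ 3\<close>
            by (simp add: algebra_simps power_numeral_reduce)
          ultimately have "int p dvd 3 * form_eval ?F x y"
            using F by (metis dvd_add dvd_mult)
          then have "int p dvd form_eval ?F x y" using nd(2) by (metis dvd_mult_p)
          then show False using sol \<open>\<not> int p dvd h\<close> by (simp add: cong_dvd_iff)
        qed
        then show ?thesis using lift_y sol by blast
      next
        case False
        then show ?thesis using lift_x sol by blast
      qed
    qed
  qed
  ultimately show ?thesis unfolding locally_represents_iff b_def by blast
qed

section \<open>Reduction theory\<close>

definition mat2 :: "int \<Rightarrow> int \<Rightarrow> int \<Rightarrow> int \<Rightarrow> int ^ 2 ^ 2" where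
  "mat2 p q r s = vector [vector [p, q], vector [r, s]]"

lemma mat2_nth [simp]:
  "mat2 p q r s $ 1 $ 1 = p" "mat2 p q r s $ 1 $ 2 = q"
  "mat2 p q r s $ 2 $ 1 = r" "mat2 p q r s $ 2 $ 2 = s"
  by (simp_all add: mat2_def vector_2)

lemma invertible_mat2:
  assumes "p * s - q * r = 1"
  shows "invertible (mat2 p q r s)"
  unfolding invertible_def
proof (intro exI[of _ "mat2 s (- q) (- r) p"] conjI)
  show "mat2 p q r s ** mat2 s (- q) (- r) p = mat 1" "mat2 s (- q) (- r) p ** mat2 p q r s = mat 1"
    using assms
    by (simp_all add: vec_eq_iff matrix_matrix_mult_def mat_def sum_2 forall_2 algebra_simps)
qed

lemma GL2Z_equiv_mat2:
  "p * s - q * r = 1 \<Longrightarrow> (F, form_subst F (mat2 p q r s)) \<in> GL2Z_equiv"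
  unfolding GL2Z_equiv_def using invertible_mat2 by blast

lemma det_invertible_int:
  fixes A :: "int ^ 2 ^ 2"
  assumes "invertible A"
  shows "\<bar>det A\<bar> = 1"
proof -
  obtain B where "A ** B = mat 1" using assms invertible_def by blast
  then have "det A * det B = 1" by (metis det_I det_mul)
  then show ?thesis by (metis abs_zmult_eq_1 abs_1)
qed

lemma disc_form_subst: "disc (form_subst F A) = det A ^ 6 * disc F"
  unfolding disc_eq form_subst_def Let_def form_eval_def det_2 of_int_eq_id id_apply cubic.sel
  by Groebner_Basis.algebra

lemma disc_GL2Z_equiv:
  assumes "(F, G) \<in> GL2Z_equiv"
  shows "disc G = disc F"
proof -
  obtain A where A: "invertible A" "G = form_subst F A"
    using assms unfolding GL2Z_equiv_def by blast
  have "det A ^ 6 = \<bar>det A\<bar> ^ 6" by (simp add: power_even_abs)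
  then show ?thesis using det_invertible_int[OF A(1)] A(2) by (simp add: disc_form_subst)
qed

text \<open>\<open>A'\<close> is the minimum of the form on nonzero integer vectors. A minimal
  vector is primitive, so it is the first column of a unimodular matrix; the second column is free
  up to multiples of the first, which makes \<open>B'\<close> small, and its value \<open>C'\<close>
  is at least the minimum. The coefficients are real because the definite factor of a cubic form is
  in general irrational, so the minimum comes from finiteness of a sublevel set.\<close>

lemma reduced_quadratic_form:
  fixes A B C :: real
  assumes A: "A > 0" and D: "4 * A * C - B ^ 2 > 0"
  obtains p q r s :: int and A' B' C' :: real where "p * s - q * r = 1"
    "A' = A * of_int p ^ 2 + B * of_int p * of_int r + C * of_int r ^ 2"
    "B' = 2 * A * of_int p * of_int q + B * (of_int p * of_int s + of_int q * of_int r)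
      + 2 * C * of_int r * of_int s"
    "C' = A * of_int q ^ 2 + B * of_int q * of_int s + C * of_int s ^ 2"
    "0 < A'" "\<bar>B'\<bar> \<le> A'" "A' \<le> C'"
proof -
  define Q :: "int \<times> int \<Rightarrow> real"
    where "Q = (\<lambda>(x, y). A * of_int x ^ 2 + B * of_int x * of_int y + C * of_int y ^ 2)"
  define \<delta> where "\<delta> = 4 * A * C - B ^ 2"
  have "4 * A * C > 0" using D zero_le_power2[of B] by linarith
  then have C: "C > 0" using A by (simp add: zero_less_mult_iff)
  \<comment> \<open>Completing the square in either variable bounds both coordinates on a sublevel
    set.\<close>
  have bound: "\<delta> * of_int y ^ 2 \<le> 4 * A * Q (x, y)" "\<delta> * of_int x ^ 2 \<le> 4 * C * Q (x, y)" for x y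
  proof -
    have "4 * A * Q (x, y) = (2 * A * x + B * y) ^ 2 + \<delta> * of_int y ^ 2"
      "4 * C * Q (x, y) = (2 * C * y + B * x) ^ 2 + \<delta> * of_int x ^ 2"
      by (simp_all add: Q_def \<delta>_def algebra_simps power2_eq_square)
    then show "\<delta> * of_int y ^ 2 \<le> 4 * A * Q (x, y)" "\<delta> * of_int x ^ 2 \<le> 4 * C * Q (x, y)"
      by simp_all
  qed
  have Qpos: "Q v > 0" if "v \<noteq> (0, 0)" for v
  proof -
    obtain x y where v: "v = (x, y)" by (cases v)
    have "\<delta> * of_int y ^ 2 > 0 \<or> \<delta> * of_int x ^ 2 > 0"
      using that v D \<delta>_def by (auto simp: zero_less_mult_iff)
    then have "4 * A * Q v > 0 \<or> 4 * C * Q v > 0" using bound v order_less_le_trans by blast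
    then show ?thesis using A C by (auto simp: zero_less_mult_iff)
  qed
  have fin: "finite {v. v \<noteq> (0, 0) \<and> Q v \<le> A}"
  proof -
    obtain N :: nat where N: "4 * A * A / \<delta> + 4 * C * A / \<delta> \<le> N"
      using real_arch_simple by blast
    have "{v. v \<noteq> (0, 0) \<and> Q v \<le> A} \<subseteq> {- int N..int N} \<times> {- int N..int N}"
    proof (intro subsetI)
      fix v assume "v \<in> {v. v \<noteq> (0, 0) \<and> Q v \<le> A}"
      moreover obtain x y where v: "v = (x, y)" by (cases v)
      ultimately have QA: "Q (x, y) \<le> A" by simp
      have d: "\<delta> > 0" using D \<delta>_def by simp
      have "4 * A * A / \<delta> \<ge> 0" "4 * C * A / \<delta> \<ge> 0" using A C d by simp_all
      moreover have "4 * A * Q (x, y) \<le> 4 * A * A" "4 * C * Q (x, y) \<le> 4 * C * A"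
        using QA A C by simp_all
      then have "\<delta> * of_int y ^ 2 \<le> 4 * A * A" "\<delta> * of_int x ^ 2 \<le> 4 * C * A"
        using bound(1)[of y x] bound(2)[of x y] by linarith+
      then have "of_int y ^ 2 \<le> 4 * A * A / \<delta>" "of_int x ^ 2 \<le> 4 * C * A / \<delta>"
        using d by (simp_all add: field_simps)
      ultimately have "real_of_int (y ^ 2) \<le> real N" "real_of_int (x ^ 2) \<le> real N"
        using N by (simp_all)
      then have "y ^ 2 \<le> int N" "x ^ 2 \<le> int N" by linarith+
      moreover have "\<bar>z\<bar> \<le> z ^ 2" for z :: int
        by (metis abs_ge_zero abs_le_square_iff abs_power2 self_le_power power2_abs int_one_le_iff_zero_less
            order_le_less zero_less_numeral zero_power2 abs_zero)
      ultimately have "\<bar>y\<bar> \<le> int N" "\<bar>x\<bar> \<le> int N" by (meson order_trans)+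
      then show "v \<in> {- int N..int N} \<times> {- int N..int N}" using v by auto
    qed
    then show ?thesis by (rule finite_subset) simp
  qed
  \<comment> \<open>Since \<open>Q (1, 0) = A\<close>, the sublevel set is nonempty and its minimum
    is the global one.\<close>
  have "(1, 0) \<in> {v. v \<noteq> (0, 0) \<and> Q v \<le> A}" by (simp add: Q_def)
  then obtain v where v: "v \<noteq> (0, 0)" "Q v \<le> A"
    and vmin: "\<And>w. w \<noteq> (0, 0) \<Longrightarrow> Q w \<le> A \<Longrightarrow> Q v \<le> Q w"
    using arg_min_if_finite[OF fin, of Q] arg_min_least[OF fin, of _ Q] by blast
  have min: "Q v \<le> Q w" if "w \<noteq> (0, 0)" for w
    using vmin[OF that] v(2) by (cases "Q w \<le> A") auto
  obtain p r where pr: "v = (p, r)" by (cases v)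
  define g where "g = gcd p r"
  have g0: "g > 0" using v pr by (simp add: g_def gcd_pos_int)
  obtain p' r' where p': "p = g * p'" "r = g * r'" using g_def by (metis dvd_def gcd_dvd1 gcd_dvd2)
  have p'0: "(p', r') \<noteq> (0, 0)" using v pr p' by auto
  \<comment> \<open>Dividing a minimal vector by its gcd divides the value by \<open>g ^ 2\<close>,
    so minimality forces \<open>g = 1\<close>.\<close>
  have "Q (p, r) = of_int g ^ 2 * Q (p', r')"
    by (simp add: Q_def p' algebra_simps power2_eq_square)
  then have "of_int g ^ 2 * Q (p', r') \<le> 1 * Q (p', r')" using min[OF p'0] pr by simp
  then have "real_of_int g ^ 2 \<le> 1" using Qpos[OF p'0] mult_le_cancel_right by fastforce
  then have "g ^ 2 \<le> 1" by (metis of_int_le_1_iff of_int_power)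
  then have "g = 1" using g0 by (simp add: abs_square_le_1)
  then obtain s0 t0 where "p * s0 + r * t0 = 1"
    using g_def bezout_int[of p r] by (metis mult.commute)
  \<comment> \<open>Adding \<open>n\<close> times the column \<open>(p, r)\<close> to
    \<open>(- t0, s0)\<close> changes the middle coefficient by \<open>2 * n * Q v\<close>; rounding
    leaves at most half of \<open>2 * Q v\<close>.\<close>
  define n :: int where "n = - round ((2 * A * p * (- t0) + B * (p * s0 - t0 * r) + 2 * C * r * s0) / (2 * Q v))"
  define q where "q = - t0 + n * p"
  define s where "s = s0 + n * r"
  have det: "p * s - q * r = 1"
    using \<open>p * s0 + r * t0 = 1\<close> by (simp add: q_def s_def algebra_simps)
  let ?B0 = "2 * A * p * (- t0) + B * (p * s0 - t0 * r) + 2 * C * r * s0"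
  let ?B' = "2 * A * p * q + B * (p * s + q * r) + 2 * C * r * s"
  have Qv: "Q v > 0" using Qpos v by blast
  have "?B' = ?B0 + 2 * n * Q v"
    by (simp add: q_def s_def pr Q_def algebra_simps power2_eq_square)
  also have "\<dots> = 2 * Q v * (?B0 / (2 * Q v) - round (?B0 / (2 * Q v)))"
    using Qv by (simp add: n_def field_simps)
  finally have "\<bar>?B'\<bar> = 2 * Q v * \<bar>?B0 / (2 * Q v) - round (?B0 / (2 * Q v))\<bar>"
    using Qv by (simp only: abs_mult)
  also have "\<bar>?B0 / (2 * Q v) - round (?B0 / (2 * Q v))\<bar> \<le> 1 / 2"
    using of_int_round_abs_le[of "?B0 / (2 * Q v)"] by (subst abs_minus_commute)
  then have "2 * Q v * \<bar>?B0 / (2 * Q v) - round (?B0 / (2 * Q v))\<bar> \<le> 2 * Q v * (1 / 2)"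
    using Qv by (intro mult_left_mono) simp_all
  finally have B': "\<bar>?B'\<bar> \<le> Q v" by simp
  have "(q, s) \<noteq> (0, 0)" using det by auto
  from min[OF this] have "Q v \<le> A * of_int q ^ 2 + B * of_int q * of_int s + C * of_int s ^ 2"
    by (simp add: Q_def)
  moreover have "Q v = A * of_int p ^ 2 + B * of_int p * of_int r + C * of_int r ^ 2"
    by (simp add: Q_def pr)
  moreover have "\<bar>2 * A * of_int p * of_int q + B * (of_int p * of_int s + of_int q * of_int r)
      + 2 * C * of_int r * of_int s\<bar> \<le> Q v"
    using B' by simp
  ultimately show ?thesis using that[OF det _ refl refl] Qv by blast
qed
text \<open>The classical syzygy between a cubic form, its Hessian and its cubic covariant, read off
  at the point (1, 0).\<close>

lemma hessian_syzygy:
  "4 * (cf1 F ^ 2 - 3 * cf0 F * cf2 F) ^ 3 = (2 * cf1 F ^ 3 + 27 * cf0 F ^ 2 * cf3 F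
    - 9 * cf0 F * cf1 F * cf2 F) ^ 2 + 27 * disc F * cf0 F ^ 2"
  unfolding disc_eq by (simp add: algebra_simps power_numeral_reduce)

text \<open>For positive discriminant the Hessian \<open>P x^2 + Q x y + R y^2\<close> is positive
  definite with \<open>4 P R - Q^2 = 3 disc F\<close>. Once it is reduced,
  \<open>3 A^2 \<le> 4 A C - B^2\<close> bounds its leading coefficient \<open>A\<close>, and the
  syzygy then bounds that of the cubic.\<close>

lemma reduced_hessian_representative:
  fixes L :: real
  assumes D: "disc F > 0" "disc F < L ^ 4" and L: "L > 0"
  obtains G where "(F, G) \<in> GL2Z_equiv" "of_int (cf0 G) ^ 2 \<le> L ^ 2"
    "cf0 G = 0 \<Longrightarrow> of_int (cf1 G) ^ 2 \<le> L ^ 2"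
    "\<bar>of_int (cf1 G ^ 2 - 3 * cf0 G * cf2 G)\<bar> \<le> L ^ 2"
proof -
  define a b c d where abcd: "a = cf0 F" "b = cf1 F" "c = cf2 F" "d = cf3 F"
  have disc: "disc F = b ^ 2 * c ^ 2 - 4 * a * c ^ 3 - 4 * b ^ 3 * d + 18 * a * b * c * d - 27 * a ^ 2 * d ^ 2"
    unfolding disc_eq abcd by simp
  define P Q R where PQR: "P = b ^ 2 - 3 * a * c" "Q = b * c - 9 * a * d" "R = c ^ 2 - 3 * b * d"
  have PQR_disc: "4 * P * R - Q ^ 2 = 3 * disc F"
    unfolding PQR disc by Groebner_Basis.algebra
  have syzygy: "4 * P ^ 3 = (2 * b ^ 3 + 27 * a ^ 2 * d - 9 * a * b * c) ^ 2 + 27 * disc F * a ^ 2"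
    unfolding PQR abcd by (rule hessian_syzygy)
  have "P > 0"
  proof (cases "a = 0")
    case True
    then have "b \<noteq> 0" using D(1) disc by auto
    then show ?thesis using True PQR by simp
  next
    case False
    then have "27 * disc F * a ^ 2 > 0" using D(1) by simp
    then have "4 * P ^ 3 > 0" using syzygy zero_le_power2[of "2 * b ^ 3 + 27 * a ^ 2 * d - 9 * a * b * c"]
      by linarith
    then show ?thesis by (simp add: zero_less_power_eq)
  qed
  have "4 * real_of_int P * of_int R - of_int Q ^ 2 = of_int (3 * disc F)"
    unfolding PQR_disc[symmetric] by simp
  then have "4 * real_of_int P * of_int R - of_int Q ^ 2 > 0" using D(1) by simp
  from reduced_quadratic_form[OF _ this] \<open>P > 0\<close>
  obtain p q r s :: int and A B C :: real where pqrs: "p * s - q * r = 1"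
    and A: "A = of_int P * of_int p ^ 2 + of_int Q * of_int p * of_int r + of_int R * of_int r ^ 2"
    and red: "0 < A" "\<bar>B\<bar> \<le> A" "A \<le> C"
    and B: "B = 2 * of_int P * of_int p * of_int q + of_int Q * (of_int p * of_int s + of_int q * of_int r)
      + 2 * of_int R * of_int r * of_int s"
    and C: "C = of_int P * of_int q ^ 2 + of_int Q * of_int q * of_int s + of_int R * of_int s ^ 2"
    by (metis of_int_0_less_iff)
  define G where "G = form_subst F (mat2 p q r s)"
  have FG: "(F, G) \<in> GL2Z_equiv" unfolding G_def by (rule GL2Z_equiv_mat2[OF pqrs])
  have pqrs2: "(p * s - q * r) ^ 2 = 1" using pqrs by simp
  have "cf1 G ^ 2 - 3 * cf0 G * cf2 G = (p * s - q * r) ^ 2 * (P * p ^ 2 + Q * p * r + R * r ^ 2)"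
    unfolding G_def form_subst_def Let_def form_eval_def PQR abcd cubic.sel mat2_nth of_int_eq_id id_apply
    by Groebner_Basis.algebra
  then have PG: "of_int (cf1 G ^ 2 - 3 * cf0 G * cf2 G) = A" unfolding A pqrs2 by simp
  have "4 * A * C - B ^ 2 = (of_int p * of_int s - of_int q * of_int r) ^ 2 * (4 * of_int P * of_int R - of_int Q ^ 2)"
    unfolding A B C by Groebner_Basis.algebra
  also have "(of_int p * of_int s - of_int q * of_int r :: real) ^ 2 = of_int ((p * s - q * r) ^ 2)"
    by simp
  finally have discABC: "4 * A * C - B ^ 2 = 3 * of_int (disc F)"
    unfolding pqrs2 using \<open>4 * real_of_int P * of_int R - of_int Q ^ 2 = of_int (3 * disc F)\<close> by simp
  have "B ^ 2 \<le> A ^ 2" using red by (simp add: abs_le_square_iff[symmetric])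
  moreover have "A ^ 2 \<le> A * C" using red by (simp add: power2_eq_square)
  ultimately have AD: "A ^ 2 \<le> of_int (disc F)" using discABC by simp
  also have "\<dots> < (L ^ 2) ^ 2" using D(2) by simp
  finally have "A ^ 2 < (L ^ 2) ^ 2" .
  then have AL: "A \<le> L ^ 2" using power2_less_imp_less[of A "L ^ 2"] by simp
  have dG: "disc G = disc F" by (rule disc_GL2Z_equiv[OF FG])
  \<comment> \<open>The syzygy with its square dropped. Combined with
    \<open>A ^ 2 \<le> disc F\<close>, the discriminant cancels and leaves
    \<open>27 a^2 \<le> 4 A\<close>.\<close>
  have "27 * disc F * cf0 G ^ 2 \<le> 4 * (cf1 G ^ 2 - 3 * cf0 G * cf2 G) ^ 3"
    unfolding hessian_syzygy dG by simp
  then have "real_of_int (27 * disc F * cf0 G ^ 2) \<le> of_int (4 * (cf1 G ^ 2 - 3 * cf0 G * cf2 G) ^ 3)"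
    by (simp only: of_int_le_iff)
  also have "\<dots> = 4 * A ^ 3" unfolding PG[symmetric] by simp
  also have "4 * A ^ 3 = 4 * A * A ^ 2" by (simp add: power_numeral_reduce)
  also have "\<dots> \<le> 4 * A * of_int (disc F)" using AD red by (intro mult_left_mono) simp_all
  finally have "of_int (disc F) * (27 * real_of_int (cf0 G) ^ 2) \<le> of_int (disc F) * (4 * A)"
    by (simp add: mult_ac)
  then have "27 * real_of_int (cf0 G) ^ 2 \<le> 4 * A" using D(1) by simp
  then have "of_int (cf0 G) ^ 2 \<le> L ^ 2" using AL red by simp
  moreover have "of_int (cf1 G) ^ 2 \<le> L ^ 2" if "cf0 G = 0"
    using that PG AL by simp
  moreover have "\<bar>of_int (cf1 G ^ 2 - 3 * cf0 G * cf2 G)\<bar> \<le> L ^ 2"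
    unfolding PG using red AL by simp
  ultimately show ?thesis using that FG by blast
qed

section \<open>Negative discriminant: a real linear factor times a definite one\<close>

lemma cubic_real_root:
  fixes a b c d :: int
  assumes "a > 0"
  obtains t :: real where "of_int a * t ^ 3 + of_int b * t ^ 2 + of_int c * t + of_int d = 0"
proof -
  define f where "f = (\<lambda>t :: real. of_int a * t ^ 3 + of_int b * t ^ 2 + of_int c * t + of_int d)"
  \<comment> \<open>Chosen so that \<open>M ^ 3\<close> is \<open>M ^ 2\<close> times the sum of 1
    and the absolute values of the lower coefficients, hence outweighs all lower terms.\<close>
  define M :: real where "M = 1 + \<bar>of_int b\<bar> + \<bar>of_int c\<bar> + \<bar>of_int d\<bar>"
  have M: "M \<ge> 1" by (simp add: M_def)
  then have M2: "M \<le> M ^ 2" "1 \<le> M ^ 2" by (simp_all add: self_le_power)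
  have a1: "real_of_int a \<ge> 1" using assms by simp
  have "\<bar>of_int b * M ^ 2\<bar> \<le> \<bar>of_int b\<bar> * M ^ 2" by (simp add: abs_mult)
  moreover have "\<bar>of_int c * M\<bar> \<le> \<bar>of_int c\<bar> * M ^ 2"
    using M M2 by (simp add: abs_mult mult_left_mono)
  moreover have "\<bar>of_int d\<bar> \<le> \<bar>of_int d\<bar> * M ^ 2"
    using mult_left_mono[OF M2(2), of "\<bar>of_int d\<bar>"] by simp
  moreover have "M ^ 3 = M ^ 2 + \<bar>of_int b\<bar> * M ^ 2 + \<bar>of_int c\<bar> * M ^ 2 + \<bar>of_int d\<bar> * M ^ 2"
  proof -
    have "M ^ 3 = M * M ^ 2" by (simp add: power_numeral_reduce)
    also have "\<dots> = (1 + \<bar>of_int b\<bar> + \<bar>of_int c\<bar> + \<bar>of_int d\<bar>) * M ^ 2" by (simp only: M_def)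
    finally show ?thesis by (simp add: algebra_simps)
  qed
  moreover have "1 * M ^ 3 \<le> of_int a * M ^ 3" using a1 M by (intro mult_right_mono) auto
  moreover have "of_int a * (- M) ^ 3 = - (of_int a * M ^ 3)" "of_int c * - M = - (of_int c * M)"
    by simp_all
  ultimately have "f M \<ge> 0" "f (- M) \<le> 0" unfolding f_def power2_minus using M2 by linarith+
  moreover have "continuous_on {- M..M} f" unfolding f_def by (intro continuous_intros)
  ultimately obtain t where "f t = 0" using IVT'[of f "- M" 0 M] M by auto
  then show ?thesis using that f_def by blast
qed

text \<open>A real root splits off a linear factor. The discriminant is that of the quadratic
  cofactor times a squared resultant, so a negative sign makes the cofactor definite; signs are
  exchanged with the linear factor to get \<open>A > 0\<close>.\<close>

lemma cubic_linear_times_definite: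
  assumes D: "disc F < 0"
  obtains \<alpha> \<beta> A B C :: real where "A > 0" "4 * A * C - B ^ 2 > 0"
    "of_int (cf0 F) = \<alpha> * A" "of_int (cf1 F) = \<alpha> * B + \<beta> * A"
    "of_int (cf2 F) = \<alpha> * C + \<beta> * B" "of_int (cf3 F) = \<beta> * C"
proof -
  note main = that
  have sgn: thesis
    if e: "of_int (cf0 F) = \<alpha> * A" "of_int (cf1 F) = \<alpha> * B + \<beta> * A"
      "of_int (cf2 F) = \<alpha> * C + \<beta> * B" "of_int (cf3 F) = \<beta> * C" for \<alpha> \<beta> A B C :: real
  proof -
    have "real_of_int (disc F) = (B ^ 2 - 4 * A * C) * (A * \<beta> ^ 2 - B * \<alpha> * \<beta> + C * \<alpha> ^ 2) ^ 2"
      unfolding disc_eq of_int_add of_int_diff of_int_mult of_int_power of_int_numeral e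
      by Groebner_Basis.algebra
    then have "(B ^ 2 - 4 * A * C) * (A * \<beta> ^ 2 - B * \<alpha> * \<beta> + C * \<alpha> ^ 2) ^ 2 < 0"
      using D by simp
    then have pos: "4 * A * C - B ^ 2 > 0"
      by (simp add: mult_less_0_iff)
    then have "A \<noteq> 0" by auto
    show thesis
    proof (cases "A > 0")
      case True
      then show ?thesis using main[of A C B \<alpha> \<beta>] pos e by blast
    next
      case False
      then show ?thesis using main[of "- A" "- C" "- B" "- \<alpha>" "- \<beta>"] pos e \<open>A \<noteq> 0\<close> by simp
    qed
  qed
  define a b c d where abcd: "a = cf0 F" "b = cf1 F" "c = cf2 F" "d = cf3 F"
  have nonzero: thesis
    if "\<sigma> * a > 0" "\<sigma> ^ 2 = 1" for \<sigma> :: int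
  proof -
    obtain t :: real where t: "of_int (\<sigma> * a) * t ^ 3 + of_int (\<sigma> * b) * t ^ 2 + of_int (\<sigma> * c) * t
        + of_int (\<sigma> * d) = 0"
      using cubic_real_root[OF \<open>\<sigma> * a > 0\<close>] by blast
    have "\<sigma> \<noteq> 0" using that by auto
    have "of_int \<sigma> * (of_int a * t ^ 3 + of_int b * t ^ 2 + of_int c * t + of_int d) = 0"
      using t by (simp add: algebra_simps)
    then have "of_int a * t ^ 3 + of_int b * t ^ 2 + of_int c * t + of_int d = 0"
      using \<open>\<sigma> \<noteq> 0\<close> by simp
    \<comment> \<open>Horner division by \<open>x - t y\<close>.\<close>
    then show thesis
      by (intro sgn[of 1 "of_int a" "of_int b + t * of_int a" "- t"
            "of_int c + t * (of_int b + t * of_int a)"])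
        (simp_all add: abcd[symmetric] algebra_simps power_numeral_reduce)
  qed
  show thesis
  proof (cases "a = 0")
    case True
    show thesis
      by (rule sgn[of 0 "of_int b" "of_int c" 1 "of_int d"]) (simp_all add: abcd[symmetric] True)
  next
    case False
    then show thesis using nonzero[of 1] nonzero[of "-1"] by fastforce
  qed
qed

text \<open>The Hessian is now indefinite, so the definite factor is reduced instead. Reducedness
  gives \<open>A^2 \<le> 4 A C - B^2\<close> and
  \<open>C \<alpha>^2 + A \<beta>^2 \<le> 2 \<rho>\<close>; together they bound
  \<open>A C \<alpha>^2 + A^2 \<beta>^2\<close>, which controls \<open>a\<close>, \<open>b\<close>
  and \<open>a c\<close>.\<close>

lemma reduced_negative_representative:
  fixes L :: real
  assumes D: "disc F < 0" "- disc F < L ^ 4" and L: "L > 0"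
  obtains G where "(F, G) \<in> GL2Z_equiv" "of_int (cf0 G) ^ 2 \<le> 2 * L ^ 2"
    "of_int (cf1 G) ^ 2 \<le> 4 * L ^ 2"
    "\<bar>of_int (cf1 G ^ 2 - 3 * cf0 G * cf2 G)\<bar> \<le> 13 * L ^ 2"
proof -
  obtain \<alpha>0 \<beta>0 A0 B0 C0 :: real where pos0: "A0 > 0" "4 * A0 * C0 - B0 ^ 2 > 0"
    and F: "of_int (cf0 F) = \<alpha>0 * A0" "of_int (cf1 F) = \<alpha>0 * B0 + \<beta>0 * A0"
      "of_int (cf2 F) = \<alpha>0 * C0 + \<beta>0 * B0" "of_int (cf3 F) = \<beta>0 * C0"
    using cubic_linear_times_definite[OF D(1)] by metis
  from reduced_quadratic_form[OF pos0]
  obtain p q r s :: int and A B C :: real where pqrs: "p * s - q * r = 1"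
    and A: "A = A0 * of_int p ^ 2 + B0 * of_int p * of_int r + C0 * of_int r ^ 2"
    and B: "B = 2 * A0 * of_int p * of_int q + B0 * (of_int p * of_int s + of_int q * of_int r)
      + 2 * C0 * of_int r * of_int s"
    and C: "C = A0 * of_int q ^ 2 + B0 * of_int q * of_int s + C0 * of_int s ^ 2"
    and red: "0 < A" "\<bar>B\<bar> \<le> A" "A \<le> C"
    by metis
  define G where "G = form_subst F (mat2 p q r s)"
  have FG: "(F, G) \<in> GL2Z_equiv" unfolding G_def by (rule GL2Z_equiv_mat2[OF pqrs])
  define \<alpha> \<beta> where \<alpha>\<beta>: "\<alpha> = \<alpha>0 * of_int p + \<beta>0 * of_int r" "\<beta> = \<alpha>0 * of_int q + \<beta>0 * of_int s"
  have G: "of_int (cf0 G) = \<alpha> * A" "of_int (cf1 G) = \<alpha> * B + \<beta> * A"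
    "of_int (cf2 G) = \<alpha> * C + \<beta> * B" "of_int (cf3 G) = \<beta> * C"
    unfolding G_def form_subst_def Let_def form_eval_def cubic.sel mat2_nth of_int_eq_id id_apply
      of_int_add of_int_mult of_int_power of_int_numeral F A B C \<alpha>\<beta>
    by (simp_all add: algebra_simps power_numeral_reduce)
  \<comment> \<open>The resultant of the two factors: the quadratic factor at the zero
    \<open>(\<beta>, - \<alpha>)\<close> of the linear one.\<close>
  define \<rho> where "\<rho> = A * \<beta> ^ 2 - B * \<alpha> * \<beta> + C * \<alpha> ^ 2"
  have "real_of_int (disc F) = real_of_int (disc G)" using disc_GL2Z_equiv[OF FG] by simp
  also have "\<dots> = (B ^ 2 - 4 * A * C) * \<rho> ^ 2"
    unfolding disc_eq of_int_add of_int_diff of_int_mult of_int_power of_int_numeral G \<rho>_def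
    by Groebner_Basis.algebra
  finally have disc: "real_of_int (- disc F) = (4 * A * C - B ^ 2) * \<rho> ^ 2"
    by (simp add: algebra_simps)
  have \<alpha>\<beta>_le: "\<bar>\<alpha> * \<beta>\<bar> \<le> (\<alpha> ^ 2 + \<beta> ^ 2) / 2"
    using sum_squares_bound[of "\<bar>\<alpha>\<bar>" "\<bar>\<beta>\<bar>"] by (simp add: abs_mult)
  have "B * \<alpha> * \<beta> \<le> \<bar>B\<bar> * \<bar>\<alpha> * \<beta>\<bar>" by (metis abs_ge_self abs_mult mult.assoc)
  also have "\<dots> \<le> A * ((\<alpha> ^ 2 + \<beta> ^ 2) / 2)"
    using red \<alpha>\<beta>_le by (intro mult_mono) auto
  finally have "B * \<alpha> * \<beta> \<le> (A * \<alpha> ^ 2 + A * \<beta> ^ 2) / 2" by (simp add: algebra_simps)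
  moreover have "A * \<alpha> ^ 2 \<le> C * \<alpha> ^ 2" using red by (intro mult_right_mono) auto
  ultimately have \<rho>: "C * \<alpha> ^ 2 + A * \<beta> ^ 2 \<le> 2 * \<rho>" unfolding \<rho>_def by simp
  have nonneg: "0 \<le> A * \<beta> ^ 2" "0 \<le> A * \<alpha> ^ 2" using red by simp_all
  then have \<rho>0: "\<rho> \<ge> 0" using \<rho> \<open>A * \<alpha> ^ 2 \<le> C * \<alpha> ^ 2\<close> by linarith
  have "B ^ 2 \<le> A ^ 2" using red by (simp add: abs_le_square_iff[symmetric])
  moreover have "A ^ 2 \<le> A * C" using red by (simp add: power2_eq_square)
  ultimately have "A ^ 2 \<le> 4 * A * C - B ^ 2" using zero_le_power2[of A] by linarith
  then have "A ^ 2 * \<rho> ^ 2 \<le> real_of_int (- disc F)" unfolding disc by (intro mult_right_mono) auto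
  also have "\<dots> < L ^ 4" by (rule D(2))
  finally have "(A * \<rho>) ^ 2 \<le> (L ^ 2) ^ 2" by (simp add: power_mult_distrib)
  then have A\<rho>: "A * \<rho> \<le> L ^ 2" by (rule power2_le_imp_le) simp
  have "A * (C * \<alpha> ^ 2 + A * \<beta> ^ 2) \<le> A * (2 * \<rho>)" using \<rho> red by (intro mult_left_mono) auto
  then have "A * C * \<alpha> ^ 2 + A ^ 2 * \<beta> ^ 2 \<le> 2 * (A * \<rho>)"
    by (simp add: algebra_simps power2_eq_square)
  then have key: "A * C * \<alpha> ^ 2 + A ^ 2 * \<beta> ^ 2 \<le> 2 * L ^ 2" using A\<rho> by linarith
  have ACA: "A ^ 2 * \<alpha> ^ 2 \<le> A * C * \<alpha> ^ 2"
    using \<open>A ^ 2 \<le> A * C\<close> by (intro mult_right_mono) auto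
  have nn: "0 \<le> A ^ 2 * \<alpha> ^ 2" "0 \<le> A ^ 2 * \<beta> ^ 2" by simp_all
  have "real_of_int (cf0 G) ^ 2 = A ^ 2 * \<alpha> ^ 2" unfolding G by (simp add: power_mult_distrib)
  then have a: "of_int (cf0 G) ^ 2 \<le> 2 * L ^ 2" using key ACA nn by linarith
  have "(\<alpha> * B + \<beta> * A) ^ 2 \<le> 2 * (\<alpha> * B) ^ 2 + 2 * (\<beta> * A) ^ 2"
    using zero_le_power2[of "\<alpha> * B - \<beta> * A"] by (simp add: power2_eq_square algebra_simps)
  also have "(\<alpha> * B) ^ 2 \<le> A ^ 2 * \<alpha> ^ 2"
    using mult_right_mono[OF \<open>B ^ 2 \<le> A ^ 2\<close>, of "\<alpha> ^ 2"] by (simp add: power_mult_distrib mult.commute)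
  also have "(\<beta> * A) ^ 2 = A ^ 2 * \<beta> ^ 2" by (simp add: power_mult_distrib)
  finally have b: "of_int (cf1 G) ^ 2 \<le> 4 * L ^ 2"
    unfolding G using key ACA nn by simp
  have "\<bar>of_int (cf0 G) * of_int (cf2 G)\<bar> = \<bar>A * C * \<alpha> ^ 2 + A * B * (\<alpha> * \<beta>)\<bar>"
    unfolding G by (simp add: algebra_simps power2_eq_square)
  also have "\<dots> \<le> \<bar>A * C * \<alpha> ^ 2\<bar> + \<bar>A * B * (\<alpha> * \<beta>)\<bar>"
    by (rule abs_triangle_ineq)
  finally have "\<bar>of_int (cf0 G) * of_int (cf2 G)\<bar> \<le> A * C * \<alpha> ^ 2 + \<bar>A * B * (\<alpha> * \<beta>)\<bar>"
    using red by simp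
  moreover have "\<bar>A * B * (\<alpha> * \<beta>)\<bar> \<le> (A ^ 2 * \<alpha> ^ 2 + A ^ 2 * \<beta> ^ 2) / 2"
  proof -
    have "\<bar>A * B * (\<alpha> * \<beta>)\<bar> \<le> (A * A) * ((\<alpha> ^ 2 + \<beta> ^ 2) / 2)"
    unfolding abs_mult[of "A * B"] abs_mult[of A B] using red \<alpha>\<beta>_le by (intro mult_mono) auto
    also have "\<dots> = (A ^ 2 * \<alpha> ^ 2 + A ^ 2 * \<beta> ^ 2) / 2"
    by (simp add: power2_eq_square algebra_simps)
    finally show ?thesis .
  qed
  ultimately have ac: "\<bar>of_int (cf0 G) * of_int (cf2 G)\<bar> \<le> 3 * L ^ 2" using key ACA nn(2) by argo
  have "\<bar>of_int (cf1 G ^ 2 - 3 * cf0 G * cf2 G)\<bar>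
      \<le> real_of_int (cf1 G) ^ 2 + 3 * \<bar>of_int (cf0 G) * of_int (cf2 G)\<bar>"
    using abs_triangle_ineq4[of "real_of_int (cf1 G) ^ 2" "3 * (of_int (cf0 G) * of_int (cf2 G))"]
    by (simp add: mult.assoc abs_mult)
  \<comment> \<open>Here \<open>13 = 4 + 3 * 3\<close>.\<close>
  then have "\<bar>of_int (cf1 G ^ 2 - 3 * cf0 G * cf2 G)\<bar> \<le> 13 * L ^ 2" using ac b by linarith
  then show ?thesis using that FG a b by blast
qed

text \<open>Meant to meet every class, possibly several times, which an upper bound tolerates. The
  constants cover both signs of the discriminant.\<close>

definition reduced_nonzero :: "real \<Rightarrow> cubic set" where
  "reduced_nonzero L = {F. cf0 F \<ge> 1 \<and> of_int (cf0 F) \<le> 2 * L \<and> 0 \<le> cf1 F \<and> cf1 F < 3 * cf0 F \<and>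
     \<bar>of_int (cf1 F ^ 2 - 3 * cf0 F * cf2 F)\<bar> \<le> 13 * L ^ 2 \<and> of_int \<bar>disc F\<bar> < L ^ 4}"

text \<open>With leading coefficient 0 a translation fixes \<open>cf1\<close> and moves
  \<open>cf2\<close> by multiples of \<open>2 * cf1\<close>, so \<open>cf2\<close> is the
  coefficient to normalize.\<close>

definition reduced_zero :: "real \<Rightarrow> cubic set" where
  "reduced_zero L = {F. cf0 F = 0 \<and> cf1 F \<ge> 1 \<and> of_int (cf1 F) \<le> 2 * L \<and> 0 \<le> cf2 F \<and>
     cf2 F < 2 * cf1 F \<and> of_int \<bar>disc F\<bar> < L ^ 4}"

lemma reduced_representative:
  fixes L :: real
  assumes D: "disc F \<noteq> 0" "of_int \<bar>disc F\<bar> < L ^ 4" and L: "L > 0"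
  shows "\<exists>G \<in> reduced_nonzero L \<union> reduced_zero L. (F, G) \<in> GL2Z_equiv"
proof -
  have "\<exists>G. (F, G) \<in> GL2Z_equiv \<and> real_of_int (cf0 G) ^ 2 \<le> 4 * L ^ 2 \<and>
      (cf0 G = 0 \<longrightarrow> real_of_int (cf1 G) ^ 2 \<le> 4 * L ^ 2) \<and>
      \<bar>of_int (cf1 G ^ 2 - 3 * cf0 G * cf2 G)\<bar> \<le> 13 * L ^ 2"
  proof (cases "disc F > 0")
    case True
    then obtain G where "(F, G) \<in> GL2Z_equiv" "of_int (cf0 G) ^ 2 \<le> L ^ 2"
      "cf0 G = 0 \<Longrightarrow> of_int (cf1 G) ^ 2 \<le> L ^ 2"
      "\<bar>of_int (cf1 G ^ 2 - 3 * cf0 G * cf2 G)\<bar> \<le> L ^ 2"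
      using reduced_hessian_representative[of F L] D L by auto
    moreover have "L ^ 2 \<le> 4 * L ^ 2" "L ^ 2 \<le> 13 * L ^ 2" by simp_all
    ultimately show ?thesis by (meson order_trans)
  next
    case False
    then obtain G where "(F, G) \<in> GL2Z_equiv" "of_int (cf0 G) ^ 2 \<le> 2 * L ^ 2"
      "of_int (cf1 G) ^ 2 \<le> 4 * L ^ 2"
      "\<bar>of_int (cf1 G ^ 2 - 3 * cf0 G * cf2 G)\<bar> \<le> 13 * L ^ 2"
      using reduced_negative_representative[of F L] D L by auto
    moreover have "2 * L ^ 2 \<le> 4 * L ^ 2" by simp
    ultimately show ?thesis by (meson order_trans)
  qed
  then obtain G where FG: "(F, G) \<in> GL2Z_equiv" and G0: "real_of_int (cf0 G) ^ 2 \<le> 4 * L ^ 2"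
    and G1: "cf0 G = 0 \<Longrightarrow> real_of_int (cf1 G) ^ 2 \<le> 4 * L ^ 2"
    and GP: "\<bar>of_int (cf1 G ^ 2 - 3 * cf0 G * cf2 G)\<bar> \<le> 13 * L ^ 2" by blast
  have equiv_trans: "(F, H') \<in> GL2Z_equiv" if "(F, H) \<in> GL2Z_equiv" "(H, H') \<in> GL2Z_equiv" for H H'
    using that equiv_GL2Z_equiv unfolding equiv_def by (blast dest: transD)
  have le2L: "of_int z \<le> 2 * L" if "real_of_int z ^ 2 \<le> 4 * L ^ 2" for z
  proof (rule power2_le_imp_le)
    show "real_of_int z ^ 2 \<le> (2 * L) ^ 2" using that by (simp add: power_mult_distrib)
  qed (use L in simp)
  \<comment> \<open>The degree is odd, so minus the identity matrix negates the form.\<close>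
  have flip: "\<exists>H. (F, H) \<in> GL2Z_equiv \<and> cf0 H = \<sigma> * cf0 G \<and> cf1 H = \<sigma> * cf1 G \<and> cf2 H = \<sigma> * cf2 G"
    if "\<sigma> = 1 \<or> \<sigma> = - 1" for \<sigma>
  proof (intro exI conjI)
    show "(F, form_subst G (mat2 \<sigma> 0 0 \<sigma>)) \<in> GL2Z_equiv"
      by (rule equiv_trans[OF FG], rule GL2Z_equiv_mat2) (use that in auto)
  qed (use that in \<open>auto simp: form_subst_def Let_def form_eval_def\<close>)
  \<comment> \<open>Translations preserve \<open>cf0\<close> and \<open>P\<close>, so the bounds
    already obtained survive the normalization.\<close>
  have shift: "(F, form_subst H (mat2 1 n 0 1)) \<in> GL2Z_equiv" if "(F, H) \<in> GL2Z_equiv" for H n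
    by (rule equiv_trans[OF that], rule GL2Z_equiv_mat2) simp
  have coeffs: "cf0 (form_subst H (mat2 1 n 0 1)) = cf0 H"
    "cf1 (form_subst H (mat2 1 n 0 1)) = cf1 H + 3 * cf0 H * n"
    "cf2 (form_subst H (mat2 1 n 0 1)) = cf2 H + 2 * cf1 H * n + 3 * cf0 H * n ^ 2" for H n
    by (simp_all add: form_subst_def Let_def form_eval_def algebra_simps)
  have small: "of_int \<bar>disc H\<bar> < L ^ 4" if "(F, H) \<in> GL2Z_equiv" for H
    using disc_GL2Z_equiv[OF that] D(2) by simp
  have mod: "0 \<le> z + m * - (z div m)" "z + m * - (z div m) < m" if "m > 0" for z m :: int
    using that by (simp_all add: minus_mult_div_eq_mod pos_mod_sign pos_mod_bound)
  show ?thesis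
  proof (cases "cf0 G = 0")
    case False
    then obtain \<sigma> :: int where \<sigma>: "\<sigma> = 1 \<or> \<sigma> = - 1" "\<sigma> * cf0 G > 0"
      by (metis linorder_neqE_linordered_idom mult_1 mult_minus_left neg_0_less_iff_less)
    from flip[OF \<sigma>(1)] obtain H where FH: "(F, H) \<in> GL2Z_equiv"
      and H: "cf0 H = \<sigma> * cf0 G" "cf1 H = \<sigma> * cf1 G" "cf2 H = \<sigma> * cf2 G" by blast
    define n where "n = - (cf1 H div (3 * cf0 H))"
    define K where "K = form_subst H (mat2 1 n 0 1)"
    have K0: "cf0 K = cf0 H" by (simp add: K_def coeffs)
    have K1: "cf1 K = cf1 H + 3 * cf0 H * - (cf1 H div (3 * cf0 H))" by (simp add: K_def coeffs n_def)
    have "cf1 K ^ 2 - 3 * cf0 K * cf2 K = cf1 H ^ 2 - 3 * cf0 H * cf2 H"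
      unfolding K_def coeffs by (simp add: algebra_simps power2_eq_square)
    also have "\<dots> = cf1 G ^ 2 - 3 * cf0 G * cf2 G"
      using \<sigma>(1) by (auto simp: H)
    finally have KP: "cf1 K ^ 2 - 3 * cf0 K * cf2 K = cf1 G ^ 2 - 3 * cf0 G * cf2 G" .
    have "real_of_int (cf0 K) ^ 2 = real_of_int (cf0 G) ^ 2" using \<sigma>(1) by (auto simp: K0 H)
    then have "of_int (cf0 K) \<le> 2 * L" using le2L[of "cf0 K"] G0 by simp
    moreover have "cf0 K \<ge> 1" using \<sigma>(2) H K0 by simp
    moreover have "0 \<le> cf1 K" "cf1 K < 3 * cf0 K"
      using mod[of "3 * cf0 H" "cf1 H"] \<sigma>(2) H unfolding K0 K1 by simp_all
    moreover have FK: "(F, K) \<in> GL2Z_equiv" using shift[OF FH] K_def by simp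
    ultimately have "K \<in> reduced_nonzero L"
      using GP small[OF FK] unfolding reduced_nonzero_def KP[symmetric] by blast
    then show ?thesis using FK by blast
  next
    case True
    have "cf1 G \<noteq> 0"
    proof
      assume "cf1 G = 0"
      then have "disc G = 0" using True by (simp add: disc_eq)
      then show False using disc_GL2Z_equiv[OF FG] D(1) by simp
    qed
    then obtain \<sigma> :: int where \<sigma>: "\<sigma> = 1 \<or> \<sigma> = - 1" "\<sigma> * cf1 G > 0"
      by (metis linorder_neqE_linordered_idom mult_1 mult_minus_left neg_0_less_iff_less)
    from flip[OF \<sigma>(1)] obtain H where FH: "(F, H) \<in> GL2Z_equiv"
      and H: "cf0 H = \<sigma> * cf0 G" "cf1 H = \<sigma> * cf1 G" "cf2 H = \<sigma> * cf2 G" by blast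
    define n where "n = - (cf2 H div (2 * cf1 H))"
    define K where "K = form_subst H (mat2 1 n 0 1)"
    have K0: "cf0 K = 0" using True H by (simp add: K_def coeffs)
    have K1: "cf1 K = cf1 H" using True H by (simp add: K_def coeffs)
    have K2: "cf2 K = cf2 H + 2 * cf1 H * - (cf2 H div (2 * cf1 H))"
      using True H by (simp add: K_def coeffs n_def)
    have "real_of_int (cf1 K) ^ 2 = real_of_int (cf1 G) ^ 2" using \<sigma>(1) by (auto simp: K1 H)
    then have "of_int (cf1 K) \<le> 2 * L" using le2L[of "cf1 K"] G1 True by simp
    moreover have "cf1 K \<ge> 1" using \<sigma>(2) H K1 by simp
    moreover have "0 \<le> cf2 K" "cf2 K < 2 * cf1 K"
      using mod[of "2 * cf1 H" "cf2 H"] \<sigma>(2) H unfolding K1 K2 by simp_all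
    moreover have FK: "(F, K) \<in> GL2Z_equiv" using shift[OF FH] K_def by simp
    ultimately have "K \<in> reduced_zero L"
      using K0 small[OF FK] unfolding reduced_zero_def by blast
    then show ?thesis using FK by blast
  qed
qed

section \<open>Counting reduced forms\<close>

lemma card_int_progression_le:
  fixes m e w :: real
  assumes "m > 0" "w \<ge> 0"
  shows "finite {d :: int. \<bar>m * of_int d + e\<bar> \<le> w}"
    and "real (card {d :: int. \<bar>m * of_int d + e\<bar> \<le> w}) \<le> 2 * w / m + 1"
proof -
  have eq: "{d :: int. \<bar>m * of_int d + e\<bar> \<le> w} = {\<lceil>(- w - e) / m\<rceil>..\<lfloor>(w - e) / m\<rfloor>}"
    using assms by (auto simp: abs_le_iff ceiling_le_iff le_floor_iff field_simps)
  show "finite {d :: int. \<bar>m * of_int d + e\<bar> \<le> w}" unfolding eq by simp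
  have "(w - e) / m - (- w - e) / m = 2 * w / m" by (simp add: diff_divide_distrib)
  moreover have "2 * w / m \<ge> 0" using assms by simp
  ultimately show "real (card {d :: int. \<bar>m * of_int d + e\<bar> \<le> w}) \<le> 2 * w / m + 1"
    unfolding eq card_atLeastAtMost_int by linarith
qed

text \<open>Stands in for integral comparison: \<open>g\<close> is minus an antiderivative of a
  decreasing \<open>f\<close>.\<close>

lemma sum_int_telescope_le:
  fixes f g :: "int \<Rightarrow> real"
  assumes "m \<le> n" and "\<And>i. m < i \<Longrightarrow> f i \<le> g (i - 1) - g i"
  shows "(\<Sum>i\<in>{m + 1..n}. f i) \<le> g m - g n"
  using assms(1)
proof (induction n rule: int_ge_induct)
  case base
  then show ?case by simp
next
  case (step i)
  have "{m + 1..i + 1} = insert (i + 1) {m + 1..i}" using step.hyps by auto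
  then show ?case using step assms(2)[of "i + 1"] by simp
qed

lemma sum_inverse_sqrt_le:
  assumes "n \<ge> 0"
  shows "(\<Sum>i\<in>{1..n :: int}. 1 / sqrt (of_int i)) \<le> 2 * sqrt (of_int n)"
proof -
  have "1 / sqrt (of_int i) \<le> - 2 * sqrt (of_int (i - 1)) - - 2 * sqrt (of_int i)" if "0 < i" for i :: int
  proof -
    define s t where st: "s = sqrt (of_int i)" "t = sqrt (of_int (i - 1))"
    have "s > 0" "t \<ge> 0" "t \<le> s" "s ^ 2 - t ^ 2 = 1" using that by (simp_all add: st)
    moreover have "(s - t) * (s + t) \<le> (s - t) * (2 * s)"
      using calculation by (intro mult_left_mono) auto
    ultimately have "1 \<le> (s - t) * (2 * s)" by (simp add: algebra_simps power2_eq_square)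
    then have "1 / s \<le> - 2 * t - - 2 * s" using \<open>s > 0\<close> by (simp add: field_simps)
    then show ?thesis unfolding st .
  qed
  from sum_int_telescope_le[OF assms, of "\<lambda>i. 1 / sqrt (of_int i)" "\<lambda>i. - 2 * sqrt (of_int i)", OF this]
  show ?thesis by simp
qed

lemma sum_inverse_three_halves_le:
  assumes "1 \<le> m"
  shows "(\<Sum>i\<in>{m + 1..n :: int}. 1 / (of_int i * sqrt (of_int i))) \<le> 2 / sqrt (of_int m)"
proof (cases "m \<le> n")
  case True
  have "1 / (of_int i * sqrt (of_int i)) \<le> 2 / sqrt (of_int (i - 1)) - 2 / sqrt (of_int i)"
    if "m < i" for i :: int
  proof -
    define s t where st: "s = sqrt (of_int i)" "t = sqrt (of_int (i - 1))"
    have *: "s > 0" "t > 0" "t \<le> s" "s ^ 2 - t ^ 2 = 1" using that assms by (simp_all add: st)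
    have "t * (s + t) \<le> s * (2 * s)" using * by (intro mult_mono) auto
    then have "(s - t) * (t * (s + t)) \<le> (s - t) * (s * (2 * s))" using * by (intro mult_left_mono) auto
    moreover have "(s - t) * (t * (s + t)) = t * (s ^ 2 - t ^ 2)"
      by (simp add: algebra_simps power2_eq_square)
    ultimately have "t \<le> (s - t) * (s * (2 * s))" using *(4) by simp
    then have "t / (s * s * (s * t)) \<le> (s - t) * (s * (2 * s)) / (s * s * (s * t))"
      using * by (intro divide_right_mono) auto
    moreover have "t / (s * s * (s * t)) = 1 / (s ^ 2 * s)" using * by (simp add: power2_eq_square)
    moreover have "(s - t) * (s * (2 * s)) / (s * s * (s * t)) = 2 / t - 2 / s"
      using *(1,2) by (simp add: field_simps)
    ultimately have "1 / (s ^ 2 * s) \<le> 2 / t - 2 / s" by simp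
    moreover have "s ^ 2 = of_int i" using that assms by (simp add: st)
    ultimately show ?thesis by (simp add: st)
  qed
  from sum_int_telescope_le[OF True, of "\<lambda>i. 1 / (of_int i * sqrt (of_int i))" "\<lambda>i. 2 / sqrt (of_int i)", OF this]
  have "(\<Sum>i\<in>{m + 1..n}. 1 / (of_int i * sqrt (of_int i))) \<le> 2 / sqrt (of_int m) - 2 / sqrt (of_int n)"
    by simp
  also have "\<dots> \<le> 2 / sqrt (of_int m)" using True assms by simp
  finally show ?thesis .
qed (use assms in simp)

section \<open>The number of last coefficients d for given a, b, c\<close>

lemma disc_window:
  assumes "a \<ge> 1" and "of_int \<bar>disc (Cubic a b c d)\<bar> < (X :: real)"
  defines "U \<equiv> 27 * of_int a ^ 2 * of_int d + of_int (2 * b ^ 3 - 9 * a * b * c)"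
  defines "P \<equiv> real_of_int (b ^ 2 - 3 * a * c)"
  shows "\<bar>U ^ 2 - 4 * P ^ 3\<bar> < 27 * of_int a ^ 2 * X"
proof -
  have "4 * P ^ 3 = of_int (4 * (b ^ 2 - 3 * a * c) ^ 3)" by (simp add: P_def)
  also have "4 * (b ^ 2 - 3 * a * c) ^ 3
      = (2 * b ^ 3 + 27 * a ^ 2 * d - 9 * a * b * c) ^ 2 + 27 * disc (Cubic a b c d) * a ^ 2"
    using hessian_syzygy[of "Cubic a b c d"] by simp
  also have "real_of_int \<dots> = U ^ 2 + 27 * of_int a ^ 2 * of_int (disc (Cubic a b c d))"
    by (simp add: U_def algebra_simps)
  finally have "\<bar>U ^ 2 - 4 * P ^ 3\<bar> = 27 * of_int a ^ 2 * of_int \<bar>disc (Cubic a b c d)\<bar>"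
    by (simp add: abs_mult)
  also have "\<dots> < 27 * of_int a ^ 2 * X" using assms(1,2) by simp
  finally show ?thesis .
qed

text \<open>As \<open>d\<close> varies, \<open>U\<close> runs through a progression of difference
  \<open>27 a^2\<close>. The second claim uses only the size of \<open>U\<close>, the third that
  \<open>U^2\<close> is close to \<open>4 P^3\<close>, which leaves two short intervals;
  \<open>t\<close> is any positive lower bound for \<open>|P|\<close>.\<close>

lemma card_disc_le:
  fixes a b c :: int and X t :: real
  assumes a: "a \<ge> 1" and X: "X > 0"
  defines "S \<equiv> {d. of_int \<bar>disc (Cubic a b c d)\<bar> < X}"
  defines "P \<equiv> real_of_int (b ^ 2 - 3 * a * c)"
  shows "finite S"
    and "real (card S) \<le> 2 * sqrt (4 * \<bar>P\<bar> ^ 3 + 27 * of_int a ^ 2 * X) / (27 * of_int a ^ 2) + 1"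
    and "0 < t \<Longrightarrow> t \<le> \<bar>P\<bar> \<Longrightarrow> real (card S) \<le> 2 * X / (t * sqrt t) + 2"
proof -
  define m e :: real where me: "m = 27 * of_int a ^ 2" "e = of_int (2 * b ^ 3 - 9 * a * b * c)"
  have m: "m > 0" using a by (simp add: me)
  have win: "\<bar>(m * of_int d + e) ^ 2 - 4 * P ^ 3\<bar> < m * X" if "d \<in> S" for d
    using disc_window[OF a, of b c d X] that unfolding S_def P_def me by simp
  define w where "w = sqrt (4 * \<bar>P\<bar> ^ 3 + m * X)"
  have w: "w \<ge> 0" using X m by (simp add: w_def)
  have sub: "S \<subseteq> {d. \<bar>m * of_int d + e\<bar> \<le> w}"
  proof
    fix d assume "d \<in> S"
    from win[OF this] have "(m * of_int d + e) ^ 2 \<le> 4 * P ^ 3 + m * X" by linarith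
    also have "\<dots> \<le> 4 * \<bar>P\<bar> ^ 3 + m * X"
      using abs_ge_self[of "P ^ 3"] by (simp add: power_abs)
    finally have "\<bar>m * of_int d + e\<bar> \<le> w" unfolding w_def by (simp add: real_le_rsqrt)
    then show "d \<in> {d. \<bar>m * of_int d + e\<bar> \<le> w}" by simp
  qed
  show fin: "finite S" using card_int_progression_le(1)[OF m w] sub finite_subset by blast
  have "real (card S) \<le> 2 * w / m + 1"
    using card_mono[OF card_int_progression_le(1)[OF m w] sub]
      card_int_progression_le(2)[OF m w, of e] by linarith
  then show "real (card S) \<le> 2 * sqrt (4 * \<bar>P\<bar> ^ 3 + 27 * of_int a ^ 2 * X) / (27 * of_int a ^ 2) + 1"
    by (simp add: w_def me)
  assume t: "0 < t" "t \<le> \<bar>P\<bar>"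
  \<comment> \<open>For \<open>P > 0\<close> the centres of the two windows are \<open>r\<close> and
    \<open>- r\<close>, as \<open>r ^ 2 = 4 * |P| ^ 3\<close>.\<close>
  define r where "r = 2 * \<bar>P\<bar> * sqrt \<bar>P\<bar>"
  have P0: "\<bar>P\<bar> > 0" using t by simp
  have r: "r > 0" using P0 by (simp add: r_def)
  have "r ^ 2 = 4 * \<bar>P\<bar> ^ 2 * (sqrt \<bar>P\<bar>) ^ 2" unfolding r_def by (simp add: power_mult_distrib)
  also have "(sqrt \<bar>P\<bar>) ^ 2 = \<bar>P\<bar>" by simp
  finally have r2: "r ^ 2 = 4 * \<bar>P\<bar> ^ 3" by (simp only: power3_eq_cube power2_eq_square mult.assoc)
  define v where "v = m * X / r"
  have v: "v \<ge> 0" using m X r by (simp add: v_def)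
  define V where "V = (\<lambda>\<sigma>. {d :: int. \<bar>m * of_int d + (e + \<sigma>)\<bar> \<le> v})"
  define \<kappa> where "\<kappa> = 2 * v / m + 1"
  have cV: "finite (V \<sigma>)" "real (card (V \<sigma>)) \<le> \<kappa>" for \<sigma>
    unfolding V_def \<kappa>_def using card_int_progression_le[OF m v] by blast+
  have near: "\<bar>\<bar>u\<bar> - r\<bar> \<le> v" if "\<bar>u ^ 2 - r ^ 2\<bar> < m * X" for u
  proof -
    have "\<bar>\<bar>u\<bar> - r\<bar> * r \<le> \<bar>\<bar>u\<bar> - r\<bar> * (\<bar>u\<bar> + r)" using r by (intro mult_left_mono) auto
    also have "\<dots> = \<bar>(\<bar>u\<bar> - r) * (\<bar>u\<bar> + r)\<bar>" using r by (simp add: abs_mult)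
    also have "(\<bar>u\<bar> - r) * (\<bar>u\<bar> + r) = u ^ 2 - r ^ 2" by (simp add: algebra_simps power2_eq_square)
    also have "\<bar>\<dots>\<bar> < m * X" by (rule that)
    finally show ?thesis using r by (simp add: v_def field_simps)
  qed
  have two: "real (card S) \<le> 2 * \<kappa>"
  proof (cases "P > 0")
    case True
    have "S \<subseteq> V (- r) \<union> V r"
    proof
      fix d assume "d \<in> S"
      from win[OF this] near[of "m * of_int d + e"] r2 True
      show "d \<in> V (- r) \<union> V r" unfolding V_def by (auto simp: abs_if split: if_splits)
    qed
    then have "card S \<le> card (V (- r)) + card (V r)"
      using card_mono[of "V (- r) \<union> V r" S] card_Un_le[of "V (- r)" "V r"] cV(1) by (meson finite_UnI order_trans)
    then show ?thesis using cV(2)[of r] cV(2)[of "- r"] by linarith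
  next
    case False
    have "S \<subseteq> V 0"
    proof
      fix d assume "d \<in> S"
      define u where "u = m * of_int d + e"
      \<comment> \<open>For \<open>P < 0\<close> the distance to \<open>4 P^3\<close> is the sum
        \<open>u^2 + r^2\<close>. Both summands are below \<open>m * X\<close>, hence so is
        \<open>|u| * r\<close>, and one window around 0 suffices.\<close>
      have "4 * P ^ 3 = - (r ^ 2)" using False r2 by (simp add: abs_if split: if_splits)
      then have *: "u ^ 2 + r ^ 2 < m * X" using win[OF \<open>d \<in> S\<close>] by (simp add: u_def)
      have "(\<bar>u\<bar> * r) ^ 2 = u ^ 2 * r ^ 2" by (simp add: power_mult_distrib)
      also have "\<dots> \<le> (m * X) * (m * X)"
        using * zero_le_power2[of u] zero_le_power2[of r] m X by (intro mult_mono) linarith+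
      finally have "(\<bar>u\<bar> * r) ^ 2 \<le> (m * X) ^ 2" by (simp add: power2_eq_square)
      then have "\<bar>u\<bar> * r \<le> m * X" using m X by (intro power2_le_imp_le[of "\<bar>u\<bar> * r"]) auto
      then have "\<bar>u\<bar> \<le> v" using r by (simp add: v_def field_simps)
      then show "d \<in> V 0" by (simp add: V_def u_def)
    qed
    then have "real (card S) \<le> \<kappa>"
      using card_mono[OF cV(1)] cV(2)[of 0] by (meson of_nat_le_iff order_trans)
    moreover have "\<kappa> \<ge> 0" using v m by (simp add: \<kappa>_def)
    ultimately show ?thesis by linarith
  qed
  have "t * sqrt t \<le> \<bar>P\<bar> * sqrt \<bar>P\<bar>" using t by (intro mult_mono) auto
  then have "4 * X / r \<le> 4 * X / (2 * (t * sqrt t))"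
    using X t r unfolding r_def by (intro divide_left_mono) auto
  moreover have "2 * v / m = 2 * X / r" using m by (simp add: v_def)
  ultimately show "real (card S) \<le> 2 * X / (t * sqrt t) + 2"
    using two by (simp add: \<kappa>_def)
qed

section \<open>Summation over a, b, c\<close>

lemma card_Sigma_le:
  assumes "finite A" "\<And>x. x \<in> A \<Longrightarrow> finite (B x)" "\<And>x. x \<in> A \<Longrightarrow> real (card (B x)) \<le> f x"
  shows "finite (SIGMA x:A. B x)" "real (card (SIGMA x:A. B x)) \<le> (\<Sum>x\<in>A. f x)"
proof -
  show "finite (SIGMA x:A. B x)" using assms by auto
  have "real (card (SIGMA x:A. B x)) = (\<Sum>x\<in>A. real (card (B x)))"
    using assms by (subst card_SigmaI) auto
  also have "\<dots> \<le> (\<Sum>x\<in>A. f x)" by (intro sum_mono assms)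
  finally show "real (card (SIGMA x:A. B x)) \<le> (\<Sum>x\<in>A. f x)" .
qed

text \<open>Here the discriminant \<open>b^2 c^2 - 4 b^3 d\<close> is linear in \<open>d\<close>.
  The \<open>2 b\<close> values of \<open>c\<close> contribute \<open>L^4 / b^2 + 2 b\<close>, and
  the sum over \<open>b\<close> of the first term converges.\<close>

lemma card_reduced_zero:
  assumes L: "L \<ge> 1"
  shows "finite (reduced_zero L)" "real (card (reduced_zero L)) \<le> 14 * L ^ 4"
proof -
  define n where "n = \<lfloor>2 * L\<rfloor>"
  have n1: "n \<ge> 1" using L by (simp add: n_def le_floor_iff)
  have nL: "real_of_int n \<le> 2 * L" by (simp add: n_def)
  define S where "S = (\<lambda>b c. {d :: int. \<bar>4 * of_int b ^ 3 * of_int d + (- of_int (b ^ 2 * c ^ 2))\<bar> \<le> L ^ 4})"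
  define h where "h = (\<lambda>b :: int. L ^ 4 / (2 * of_int b ^ 3) + 1)"
  have S: "finite (S b c)" "real (card (S b c)) \<le> h b" if "b \<ge> 1" for b c
    using card_int_progression_le[of "4 * of_int b ^ 3" "L ^ 4" "- of_int (b ^ 2 * c ^ 2)"] that
    unfolding S_def h_def by auto
  let ?T = "SIGMA b:{1..n}. SIGMA c:{0..<2 * b}. S b c"
  have Sc: "finite (SIGMA c:{0..<2 * b}. S b c)"
    "real (card (SIGMA c:{0..<2 * b}. S b c)) \<le> (\<Sum>c\<in>{0..<2 * b}. h b)" if "b \<ge> 1" for b
    using card_Sigma_le[of "{0..<2 * b}" "S b" "\<lambda>_. h b"] S that by auto
  have T: "finite ?T" "real (card ?T) \<le> (\<Sum>b\<in>{1..n}. \<Sum>c\<in>{0..<2 * b}. h b)"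
    using card_Sigma_le[of "{1..n}" "\<lambda>b. SIGMA c:{0..<2 * b}. S b c"] Sc by auto
  have sub: "reduced_zero L \<subseteq> (\<lambda>(b, c, d). Cubic 0 b c d) ` ?T"
  proof
    fix F assume F: "F \<in> reduced_zero L"
    obtain a b c d where abcd: "F = Cubic a b c d" by (cases F)
    have a: "a = 0" and b: "b \<ge> 1" "of_int b \<le> 2 * L" and c: "0 \<le> c" "c < 2 * b"
      and D: "of_int \<bar>disc F\<bar> < L ^ 4"
      using F unfolding reduced_zero_def abcd by auto
    have "disc F = - (4 * b ^ 3 * d - b ^ 2 * c ^ 2)"
      unfolding disc_eq abcd a by simp
    then have "\<bar>disc F\<bar> = \<bar>4 * b ^ 3 * d - b ^ 2 * c ^ 2\<bar>" by simp
    then have "of_int \<bar>4 * b ^ 3 * d - b ^ 2 * c ^ 2\<bar> < L ^ 4" using D by simp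
    then have "d \<in> S b c" unfolding S_def by simp
    moreover have "b \<le> n" using b(2) by (simp add: n_def le_floor_iff)
    ultimately have "(b, c, d) \<in> ?T" using b c by auto
    then show "F \<in> (\<lambda>(b, c, d). Cubic 0 b c d) ` ?T" unfolding abcd a by (rule rev_image_eqI) simp
  qed
  show "finite (reduced_zero L)" using T(1) sub by (rule finite_surj)
  have "card (reduced_zero L) \<le> card ?T" using surj_card_le[OF T(1) sub] .
  then have "real (card (reduced_zero L)) \<le> (\<Sum>b\<in>{1..n}. \<Sum>c\<in>{0..<2 * b}. h b)"
    using T(2) by linarith
  also have "\<dots> = (\<Sum>b\<in>{1..n}. 2 * of_int b * h b)" by (intro sum.cong) auto
  also have "\<dots> \<le> (\<Sum>b\<in>{1..n}. L ^ 4 * (1 / (of_int b * sqrt (of_int b))) + 4 * L)"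
  proof (rule sum_mono)
    fix b assume b: "b \<in> {1..n}"
    then have b1: "real_of_int b \<ge> 1" by simp
    \<comment> \<open>Weakens \<open>1 / b^2\<close> to the exponent 3/2, for which a sum bound is
      at hand.\<close>
    have "sqrt (of_int b) \<le> real_of_int b" using b1 by (simp add: real_le_lsqrt self_le_power)
    then have "L ^ 4 / (of_int b * of_int b) \<le> L ^ 4 / (of_int b * sqrt (of_int b))"
      using b1 L by (intro divide_left_mono mult_left_mono) auto
    moreover have "2 * of_int b * h b = L ^ 4 / (of_int b * of_int b) + 2 * of_int b"
      using b1 by (simp add: h_def field_simps power_numeral_reduce)
    moreover have "2 * real_of_int b \<le> 4 * L" using b nL by auto
    ultimately show "2 * of_int b * h b \<le> L ^ 4 * (1 / (of_int b * sqrt (of_int b))) + 4 * L" by simp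
  qed
  also have "\<dots> = L ^ 4 * (\<Sum>b\<in>{1..n}. 1 / (of_int b * sqrt (of_int b))) + of_int n * (4 * L)"
    using n1 by (simp add: sum.distrib sum_distrib_left)
  also have "{1..n} = insert 1 {1 + 1..n}" using n1 by auto
  also have "(\<Sum>b\<in>insert 1 {1 + 1..n}. 1 / (real_of_int b * sqrt (of_int b)))
      = 1 + (\<Sum>b\<in>{1 + 1..n}. 1 / (of_int b * sqrt (of_int b)))"
    by simp
  also have "L ^ 4 * (1 + (\<Sum>b\<in>{1 + 1..n}. 1 / (of_int b * sqrt (of_int b)))) + of_int n * (4 * L)
      \<le> L ^ 4 * (1 + 2) + 2 * L * (4 * L)"
    using sum_inverse_three_halves_le[of 1 n] L nL
    by (intro add_mono mult_left_mono mult_right_mono) auto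
  also have "2 * L * (4 * L) \<le> 8 * L ^ 4"
    using power_increasing[of 2 4 L] L by (simp add: power2_eq_square)
  finally show "real (card (reduced_zero L)) \<le> 14 * L ^ 4" using L by simp
qed

text \<open>The range \<open>|c| \<le> 9 L\<close> has at most \<open>18 L + 1 \<le> 19 L\<close>
  members; each of the two tails of the convergent series is at most
  \<open>2 B / sqrt L\<close>.\<close>

lemma sum_small_and_large_le:
  fixes L A B :: real and a M :: int
  assumes L: "L \<ge> 1" and A: "A \<ge> 0" and B: "B \<ge> 0" and M: "M \<ge> 0"
  shows "(\<Sum>c\<in>{- M..M}. if \<bar>of_int c\<bar> \<le> 9 * L then A
      else B / (of_int \<bar>c\<bar> * sqrt (of_int \<bar>c\<bar>)) + 2)
    \<le> 19 * L * A + 4 * B / sqrt L + 2 * (2 * of_int M + 1)"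
proof -
  let ?g = "\<lambda>c :: int. 1 / (of_int c * sqrt (of_int c))"
  define k where "k = \<lfloor>9 * L\<rfloor>"
  have k: "of_int k \<le> 9 * L" "9 * L < of_int k + 1" by (simp_all add: k_def)
  have kL: "real_of_int k \<ge> L" using k L by linarith
  have k1: "k \<ge> 1" using L by (simp add: k_def le_floor_iff)
  have small: "\<bar>real_of_int c\<bar> \<le> 9 * L \<longleftrightarrow> c \<in> {- k..k}" for c
    using k by (auto simp: abs_le_iff)
  have "(\<Sum>c\<in>{- M..M}. if \<bar>of_int c\<bar> \<le> 9 * L then A
      else B / (of_int \<bar>c\<bar> * sqrt (of_int \<bar>c\<bar>)) + 2)
    \<le> (\<Sum>c\<in>{- M..M}. (if c \<in> {- k..k} then A else 0) + (if c \<in> {- k..k} then 0 else B * ?g \<bar>c\<bar>) + 2)"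
    using A B by (intro sum_mono) (simp add: small)
  also have "\<dots> = (\<Sum>c\<in>{- M..M}. if c \<in> {- k..k} then A else 0)
      + (\<Sum>c\<in>{- M..M}. if c \<in> {- k..k} then 0 else B * ?g \<bar>c\<bar>) + 2 * (2 * of_int M + 1)"
    using M by (simp add: sum.distrib)
  also have "(\<Sum>c\<in>{- M..M}. if c \<in> {- k..k} then A else 0) = (\<Sum>c\<in>{- M..M} \<inter> {- k..k}. A)"
    by (rule sum.inter_restrict[symmetric]) simp
  also have "\<dots> \<le> (\<Sum>c\<in>{- k..k}. A)" using A by (intro sum_mono2) auto
  also have "\<dots> = (2 * of_int k + 1) * A" using k1 by simp
  also have "\<dots> \<le> 19 * L * A" using k L A by (intro mult_right_mono) auto
  also have "(\<Sum>c\<in>{- M..M}. if c \<in> {- k..k} then 0 else B * ?g \<bar>c\<bar>)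
      = (\<Sum>c\<in>{- M..M} - {- k..k}. B * ?g \<bar>c\<bar>)"
    by (intro sum.mono_neutral_cong_right) auto
  also have "\<dots> \<le> (\<Sum>c\<in>{k + 1..M} \<union> uminus ` {k + 1..M}. B * ?g \<bar>c\<bar>)"
  proof (rule sum_mono2)
    show "{- M..M} - {- k..k} \<subseteq> {k + 1..M} \<union> uminus ` {k + 1..M}"
      using k1 by (auto simp: image_iff)
  qed (use B in auto)
  also have "\<dots> \<le> (\<Sum>c\<in>{k + 1..M}. B * ?g \<bar>c\<bar>) + (\<Sum>c\<in>uminus ` {k + 1..M}. B * ?g \<bar>c\<bar>)"
    using k1 B by (subst sum.union_disjoint) auto
  also have "(\<Sum>c\<in>uminus ` {k + 1..M}. B * ?g \<bar>c\<bar>) = (\<Sum>c\<in>{k + 1..M}. B * ?g \<bar>c\<bar>)"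
    by (subst sum.reindex) auto
  also have "(\<Sum>c\<in>{k + 1..M}. B * ?g \<bar>c\<bar>) = B * (\<Sum>c\<in>{k + 1..M}. ?g c)"
    unfolding sum_distrib_left using k1 by (intro sum.cong) auto
  also have "\<dots> \<le> B * (2 / sqrt (of_int k))"
    using B by (intro mult_left_mono sum_inverse_three_halves_le[OF k1])
  also have "\<dots> \<le> B * (2 / sqrt L)"
    using B L kL by (intro mult_left_mono divide_left_mono) auto
  finally show ?thesis by (simp add: algebra_simps)
qed
text \<open>For \<open>|c| \<le> 9 L\<close> each triple allows \<open>O(L^2 / a)\<close> values of
  \<open>d\<close>; with \<open>O(L)\<close> values of \<open>c\<close>, \<open>3 a\<close> of
  \<open>b\<close> and \<open>2 L\<close> of \<open>a\<close> this is \<open>O(L^4)\<close>. For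
  larger \<open>c\<close> the sum over \<open>b\<close> and \<open>c\<close> is
  \<open>O(L^(7/2) a^(-1/2))\<close>, again \<open>O(L^4)\<close> after summing over
  \<open>a\<close>. The additive constants cost one per triple, \<open>O(L^3)\<close> in
  all.\<close>

lemma card_reduced_nonzero:
  assumes L: "L \<ge> 1"
  shows "finite (reduced_nonzero L)" "real (card (reduced_nonzero L)) \<le> 10000 * L ^ 4"
proof -
  define n where "n = \<lfloor>2 * L\<rfloor>"
  have nL: "real_of_int n \<le> 2 * L" by (simp add: n_def)
  have n1: "n \<ge> 1" using L by (simp add: n_def le_floor_iff)
  \<comment> \<open>From \<open>3 a |c| \<le> b^2 + |P| \<le> 36 L^2 + 13 L^2\<close>, and
    \<open>49 / 3 < 17\<close>.\<close>
  define M where "M = (\<lambda>a. \<lfloor>17 * L ^ 2 / of_int a\<rfloor>)"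
  define S where "S = (\<lambda>a b c. {d. of_int \<bar>disc (Cubic a b c d)\<bar> < L ^ 4})"
  \<comment> \<open>The threshold \<open>9 L\<close> is where
    \<open>b^2 \<le> 9 a^2 \<le> 18 a L\<close> drops below \<open>2 a |c|\<close>; beyond it
    \<open>3 a |c| \<le> b^2 + |P|\<close> yields \<open>a |c| \<le> |P|\<close>.\<close>
  define f where "f = (\<lambda>a c :: int. if \<bar>of_int c\<bar> \<le> 9 * L then 66 * L ^ 2 / of_int a
      else 2 * L ^ 4 / (of_int a * sqrt (of_int a)) / (of_int \<bar>c\<bar> * sqrt (of_int \<bar>c\<bar>)) + 2)"
  have L4: "L ^ 4 > 0" and LL: "L \<le> L ^ 2" using L by (simp_all add: self_le_power)
  have L24: "L ^ 2 * L ^ 2 = L ^ 4" "L * L ^ 3 = L ^ 4" "L * L ^ 2 = L ^ 3"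
    by (simp_all add: power_numeral_reduce)
  have S: "finite (S a b c)" "real (card (S a b c)) \<le> f a c"
    if a: "1 \<le> a" "a \<le> n" and b: "0 \<le> b" "b < 3 * a" for a b c
  proof -
    have a1: "real_of_int a \<ge> 1" and aL: "real_of_int a \<le> 2 * L" using a nL by simp_all
    show "finite (S a b c)" unfolding S_def using card_disc_le(1)[OF a(1) L4] .
    define P where "P = real_of_int (b ^ 2 - 3 * a * c)"
    have "real_of_int b ^ 2 \<le> (3 * of_int a) ^ 2" using b by (intro power_mono) auto
    then have b2: "real_of_int b ^ 2 \<le> 9 * of_int a * of_int a" by (simp add: power2_eq_square)
    have Pabs: "\<bar>P\<bar> \<le> real_of_int b ^ 2 + 3 * (of_int a * \<bar>of_int c\<bar>)"
      "3 * (of_int a * \<bar>of_int c\<bar>) \<le> real_of_int b ^ 2 + \<bar>P\<bar>"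
      using abs_triangle_ineq4[of "real_of_int b ^ 2" "3 * of_int a * of_int c"]
        abs_triangle_ineq4[of "real_of_int b ^ 2" P] a1
      by (simp_all add: P_def abs_mult)
    show "real (card (S a b c)) \<le> f a c"
    proof (cases "\<bar>real_of_int c\<bar> \<le> 9 * L")
      case True
      have "of_int a * \<bar>real_of_int c\<bar> \<le> of_int a * (9 * L)"
        using True a1 by (intro mult_left_mono) auto
      moreover have "of_int a * of_int a \<le> of_int a * (2 * L)"
        using aL a1 by (intro mult_left_mono) auto
      ultimately have P: "\<bar>P\<bar> \<le> 45 * (of_int a * L)" using Pabs(1) b2 by simp
      have "\<bar>P\<bar> ^ 3 \<le> (45 * (of_int a * L)) ^ 3" using P by (intro power_mono) auto
      also have "\<dots> = 91125 * (of_int a ^ 2 * L ^ 3) * of_int a"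
        by (simp add: power_mult_distrib power_numeral_reduce)
      also have "\<dots> \<le> 91125 * (of_int a ^ 2 * L ^ 3) * (2 * L)"
        using aL a1 L by (intro mult_left_mono) auto
      also have "\<dots> = 182250 * (of_int a ^ 2 * L ^ 4)" by (simp add: power_numeral_reduce)
      finally have "\<bar>P\<bar> ^ 3 \<le> 182250 * (of_int a ^ 2 * L ^ 4)" .
      moreover have "0 \<le> real_of_int a ^ 2 * L ^ 4" using L4 by simp
      \<comment> \<open>\<open>729316 = 854^2\<close> is the first square above
        \<open>4 * 182250 + 27\<close>.\<close>
      ultimately have "4 * \<bar>P\<bar> ^ 3 + 27 * of_int a ^ 2 * L ^ 4 \<le> 729316 * (of_int a ^ 2 * L ^ 4)"
        unfolding mult.assoc by linarith
      also have "\<dots> = (854 * of_int a * L ^ 2) ^ 2" by (simp add: power_mult_distrib)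
      finally have "sqrt (4 * \<bar>P\<bar> ^ 3 + 27 * of_int a ^ 2 * L ^ 4) \<le> 854 * of_int a * L ^ 2"
        using a1 by (intro real_le_lsqrt) auto
      then have "2 * sqrt (4 * \<bar>P\<bar> ^ 3 + 27 * of_int a ^ 2 * L ^ 4) / (27 * of_int a ^ 2)
          \<le> 2 * (854 * of_int a * L ^ 2) / (27 * of_int a ^ 2)"
        by (intro divide_right_mono mult_left_mono) auto
      also have "\<dots> \<le> 64 * L ^ 2 / of_int a"
        using a1 by (simp add: field_simps power2_eq_square)
      finally have "real (card (S a b c)) \<le> 64 * L ^ 2 / of_int a + 1"
        using card_disc_le(2)[OF a(1) L4, of b c] unfolding S_def P_def by linarith
      moreover have "1 \<le> 2 * L ^ 2 / of_int a" using aL a1 LL by (simp add: field_simps)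
      ultimately have "real (card (S a b c)) \<le> 64 * L ^ 2 / of_int a + 2 * L ^ 2 / of_int a" by linarith
      also have "\<dots> = 66 * L ^ 2 / of_int a" by (simp add: add_divide_distrib[symmetric])
      finally show ?thesis using True by (simp add: f_def)
    next
      case False
      have "9 * of_int a * of_int a \<le> 2 * (of_int a * \<bar>real_of_int c\<bar>)"
        using mult_left_mono[of "9 * of_int a" "2 * \<bar>real_of_int c\<bar>" "of_int a"] False aL a1 by (simp add: mult_ac)
      then have t: "of_int a * \<bar>real_of_int c\<bar> \<le> \<bar>P\<bar>" using Pabs(2) b2 by linarith
      have "0 < of_int a * \<bar>real_of_int c\<bar>" using a1 False L by auto
      from card_disc_le(3)[OF a(1) L4 this, of b c] t
      have "real (card (S a b c)) \<le> 2 * L ^ 4 / (of_int a * \<bar>real_of_int c\<bar> * sqrt (of_int a * \<bar>real_of_int c\<bar>)) + 2"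
        unfolding S_def P_def by blast
      then show ?thesis using False by (simp add: f_def real_sqrt_mult mult_ac)
    qed
  qed
  \<comment> \<open>The total for one \<open>a\<close>, including the \<open>3 a\<close> choices of
    \<open>b\<close>: \<open>3 * 19 * 66 = 3762\<close>, and the lower-order terms are absorbed in
    4000.\<close>
  define B where "B = (\<lambda>a :: int. 4000 * L ^ 3 + 24 * L ^ 3 * sqrt L * (1 / sqrt (of_int a)))"
  have sum_f: "of_int (3 * a) * (\<Sum>c\<in>{- M a..M a}. f a c) \<le> B a" if a: "1 \<le> a" "a \<le> n" for a
  proof -
    have a1: "real_of_int a \<ge> 1" and aL: "real_of_int a \<le> 2 * L" using a nL by simp_all
    have M: "M a \<ge> 0" "of_int (M a) \<le> 17 * L ^ 2 / of_int a" using a1 by (simp_all add: M_def)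
    have "(\<Sum>c\<in>{- M a..M a}. f a c) \<le> 19 * L * (66 * L ^ 2 / of_int a)
        + 4 * (2 * L ^ 4 / (of_int a * sqrt (of_int a))) / sqrt L + 2 * (2 * of_int (M a) + 1)"
      unfolding f_def using a1 L M by (intro sum_small_and_large_le) auto
    also have "\<dots> \<le> 19 * L * (66 * L ^ 2 / of_int a)
        + 4 * (2 * L ^ 4 / (of_int a * sqrt (of_int a))) / sqrt L + 2 * (2 * (17 * L ^ 2 / of_int a) + 1)"
      using M by simp
    finally have "of_int (3 * a) * (\<Sum>c\<in>{- M a..M a}. f a c) \<le> of_int (3 * a) * (19 * L * (66 * L ^ 2 / of_int a)
        + 4 * (2 * L ^ 4 / (of_int a * sqrt (of_int a))) / sqrt L + 2 * (2 * (17 * L ^ 2 / of_int a) + 1))"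
      using a1 by (intro mult_left_mono) auto
    also have "\<dots> = 3762 * (L * L ^ 2) + 24 * L ^ 4 / (sqrt (of_int a) * sqrt L) + 204 * L ^ 2 + 6 * of_int a"
      using a1 L by (simp add: field_simps)
    also have "24 * L ^ 4 / (sqrt (of_int a) * sqrt L) = 24 * L ^ 3 * sqrt L * (1 / sqrt (of_int a))"
    proof -
      have "L ^ 4 / sqrt L = L ^ 3 * (L / sqrt L)" by (simp add: power_numeral_reduce)
      also have "L / sqrt L = sqrt L" using L by (simp add: real_div_sqrt)
      finally have "L ^ 4 / sqrt L = L ^ 3 * sqrt L" .
      moreover have "24 * L ^ 4 / (sqrt (of_int a) * sqrt L) = 24 * (L ^ 4 / sqrt L) * (1 / sqrt (of_int a))"
        by simp
      ultimately show ?thesis by (simp only: mult.assoc)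
    qed
    also have "L * L ^ 2 = L ^ 3" by (rule L24)
    finally have "of_int (3 * a) * (\<Sum>c\<in>{- M a..M a}. f a c)
        \<le> 3762 * L ^ 3 + 24 * L ^ 3 * sqrt L * (1 / sqrt (of_int a)) + 204 * L ^ 2 + 6 * of_int a" .
    moreover have "L ^ 2 \<le> L ^ 3" "L \<le> L ^ 3" using power_increasing[of 2 3 L] L by (simp_all add: self_le_power)
    then have "3762 * L ^ 3 + Z + 204 * L ^ 2 + 6 * of_int a \<le> 4000 * L ^ 3 + Z" for Z
      using aL L by linarith
    ultimately show ?thesis unfolding B_def by (rule order_trans)
  qed
  let ?Tb = "\<lambda>a b. SIGMA c:{- M a..M a}. S a b c"
  let ?Ta = "\<lambda>a. SIGMA b:{0..<3 * a}. ?Tb a b"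
  let ?T = "SIGMA a:{1..n}. ?Ta a"
  have Tb: "finite (?Tb a b)" "real (card (?Tb a b)) \<le> (\<Sum>c\<in>{- M a..M a}. f a c)"
    if "1 \<le> a" "a \<le> n" "0 \<le> b" "b < 3 * a" for a b
    using card_Sigma_le[of "{- M a..M a}" "S a b" "f a"] S[OF that] by auto
  have Ta: "finite (?Ta a)" "real (card (?Ta a)) \<le> B a" if a: "1 \<le> a" "a \<le> n" for a
  proof -
    have *: "finite (?Ta a)" "real (card (?Ta a)) \<le> (\<Sum>b\<in>{0..<3 * a}. \<Sum>c\<in>{- M a..M a}. f a c)"
      using card_Sigma_le[of "{0..<3 * a}" "?Tb a" "\<lambda>_. \<Sum>c\<in>{- M a..M a}. f a c"] Tb[OF a] by auto
    show "finite (?Ta a)" by (rule *)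
    show "real (card (?Ta a)) \<le> B a" using *(2) sum_f[OF a] a by simp
  qed
  have T: "finite ?T" "real (card ?T) \<le> (\<Sum>a\<in>{1..n}. B a)"
    using card_Sigma_le[of "{1..n}" ?Ta B] Ta by auto
  have sub: "reduced_nonzero L \<subseteq> (\<lambda>(a, b, c, d). Cubic a b c d) ` ?T"
  proof
    fix F assume F: "F \<in> reduced_nonzero L"
    obtain a b c d where abcd: "F = Cubic a b c d" by (cases F)
    have a: "a \<ge> 1" "of_int a \<le> 2 * L" and b: "0 \<le> b" "b < 3 * a"
      and P: "\<bar>of_int (b ^ 2 - 3 * a * c)\<bar> \<le> 13 * L ^ 2" and D: "of_int \<bar>disc F\<bar> < L ^ 4"
      using F unfolding reduced_nonzero_def abcd by auto
    have a1: "real_of_int a \<ge> 1" using a by simp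
    have an: "a \<le> n" using a by (simp add: n_def le_floor_iff)
    have "real_of_int b ^ 2 \<le> (3 * of_int a) ^ 2" using b by (intro power_mono) auto
    also have "\<dots> \<le> (3 * (2 * L)) ^ 2" using a a1 by (intro power_mono mult_left_mono) auto
    finally have b2: "real_of_int b ^ 2 \<le> 36 * L ^ 2" by (simp add: power_mult_distrib)
    have "\<bar>3 * (of_int a * real_of_int c)\<bar> \<le> 49 * L ^ 2"
      using abs_triangle_ineq4[of "real_of_int b ^ 2" "of_int (b ^ 2 - 3 * a * c)"] P b2 by simp
    then have "3 * (of_int a * \<bar>real_of_int c\<bar>) \<le> 49 * L ^ 2" using a1 by (simp add: abs_mult)
    then have "of_int a * \<bar>real_of_int c\<bar> \<le> 17 * L ^ 2" using zero_le_power2[of L] by linarith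
    then have "\<bar>real_of_int c\<bar> \<le> 17 * L ^ 2 / of_int a" using a1 by (simp add: field_simps)
    then have "\<bar>c\<bar> \<le> M a" unfolding M_def le_floor_iff by simp
    then have "(a, b, c, d) \<in> ?T" using a an b D by (auto simp: S_def abcd)
    then show "F \<in> (\<lambda>(a, b, c, d). Cubic a b c d) ` ?T" unfolding abcd by (rule rev_image_eqI) simp
  qed
  show "finite (reduced_nonzero L)" using T(1) sub by (rule finite_surj)
  have "card (reduced_nonzero L) \<le> card ?T" using surj_card_le[OF T(1) sub] .
  then have "real (card (reduced_nonzero L)) \<le> (\<Sum>a\<in>{1..n}. B a)" using T(2) by linarith
  also have "\<dots> = of_int n * (4000 * L ^ 3) + 24 * L ^ 3 * sqrt L * (\<Sum>a\<in>{1..n}. 1 / sqrt (of_int a))"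
    using n1 by (simp add: B_def sum.distrib sum_distrib_left)
  also have "\<dots> \<le> (2 * L) * (4000 * L ^ 3) + 24 * L ^ 3 * sqrt L * (2 * (2 * sqrt L))"
  proof (intro add_mono mult_right_mono mult_left_mono)
    have "sqrt (of_int n) \<le> sqrt (4 * L)" using nL L by (intro real_sqrt_le_mono) linarith
    also have "\<dots> = 2 * sqrt L" by (simp add: real_sqrt_mult)
    finally show "(\<Sum>a\<in>{1..n}. 1 / sqrt (of_int a)) \<le> 2 * (2 * sqrt L)"
      using sum_inverse_sqrt_le[of n] n1 by linarith
  qed (use nL L in auto)
  also have "\<dots> = 8000 * (L * L ^ 3) + 96 * (L ^ 3 * (sqrt L * sqrt L))" by simp
  also have "\<dots> = 8096 * L ^ 4" using L by (simp add: L24 mult.commute)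
  also have "\<dots> \<le> 10000 * L ^ 4" using L4 by simp
  finally show "real (card (reduced_nonzero L)) \<le> 10000 * L ^ 4" .
qed

section \<open>The reducible family\<close>

lemma maximal_form_family: "maximal_form (Cubic 0 b 1 d)"
  unfolding maximal_form_def proper_subform_def
proof clarify
  fix G and A :: "int ^ 2 ^ 2"
  assume det: "\<bar>det A\<bar> > 1" and F: "Cubic 0 b 1 d = form_subst G A"
  define P Q R where PQR: "P = cf1 G ^ 2 - 3 * cf0 G * cf2 G" "Q = cf1 G * cf2 G - 9 * cf0 G * cf3 G"
    "R = cf2 G ^ 2 - 3 * cf1 G * cf3 G"
  define p q r s where pqrs: "p = A $ 1 $ 1" "q = A $ 1 $ 2" "r = A $ 2 $ 1" "s = A $ 2 $ 2"
  \<comment> \<open>The Hessian of \<open>F\<close> is divisible by \<open>(det A)\<^sup>2\<close>, but two of its coefficients are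
    \<open>b\<close> and \<open>1 - 3 b d\<close>.\<close>
  have "cf1 (form_subst G A) * cf2 (form_subst G A) - 9 * cf0 (form_subst G A) * cf3 (form_subst G A)
      = det A ^ 2 * (2 * P * p * q + Q * (p * s + q * r) + 2 * R * r * s)"
    unfolding form_subst_def Let_def form_eval_def PQR det_2 of_int_eq_id id_apply cubic.sel pqrs[symmetric]
    by Groebner_Basis.algebra
  moreover have "cf2 (form_subst G A) ^ 2 - 3 * cf1 (form_subst G A) * cf3 (form_subst G A)
      = det A ^ 2 * (P * q ^ 2 + Q * q * s + R * s ^ 2)"
    unfolding form_subst_def Let_def form_eval_def PQR det_2 of_int_eq_id id_apply cubic.sel pqrs[symmetric]
    by Groebner_Basis.algebra
  ultimately have "det A ^ 2 dvd b" "det A ^ 2 dvd 1 - 3 * b * d"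
    unfolding F[symmetric] by simp_all
  then have "det A ^ 2 dvd (1 - 3 * b * d) + b * (3 * d)" by (meson dvd_add dvd_mult2)
  then have "det A ^ 2 dvd 1" by (simp add: algebra_simps)
  then have "det A ^ 2 = 1" by simp
  then have "det A = 1 \<or> det A = - 1" by (simp add: power2_eq_1_iff)
  then show False using det by auto
qed

text \<open>For \<open>y \<noteq> 0\<close> the quadratic factor \<open>q\<close> satisfies
  \<open>4 b q \<ge> 4 b d - 1\<close>, hence \<open>q \<ge> d\<close> by integrality. So nonzero
  values of the form have absolute value at least \<open>d\<close>, which exceeds
  \<open>|h|\<close>.\<close>

lemma not_globally_represents_family:
  assumes b: "b > 0" and h: "h \<noteq> 0" and d: "d > \<bar>h\<bar>"
  shows "\<not> globally_represents (Cubic 0 b 1 d) h"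
proof
  assume "globally_represents (Cubic 0 b 1 d) h"
  then obtain x y :: int where "form_eval (Cubic 0 b 1 d) x y = h"
    unfolding globally_represents_def by blast
  then have xy: "y * (b * x ^ 2 + x * y + d * y ^ 2) = h"
    by (simp add: form_eval_def algebra_simps power_numeral_reduce)
  let ?q = "b * x ^ 2 + x * y + d * y ^ 2"
  have "y \<noteq> 0" using xy h by auto
  then have y1: "\<bar>y\<bar> \<ge> 1" by simp
  then have "y ^ 2 \<ge> 1" using one_le_power[OF y1, of 2] by simp
  have "1 * 1 \<le> b * d" using b d by (intro mult_mono) auto
  then have bd: "b * d \<ge> 1" by simp
  have "4 * b * ?q = (2 * b * x + y) ^ 2 + (4 * (b * d) - 1) * y ^ 2"
    by (simp add: algebra_simps power2_eq_square)
  also have "\<dots> \<ge> 0 + (4 * (b * d) - 1) * 1"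
    using bd \<open>y ^ 2 \<ge> 1\<close> by (intro add_mono mult_left_mono) auto
  finally have "4 * b * (d - ?q) \<le> 1" by (simp add: algebra_simps)
  have "?q \<ge> d"
  proof (rule ccontr)
    assume "\<not> ?q \<ge> d"
    then have "4 * b * 1 \<le> 4 * b * (d - ?q)" using b by (intro mult_left_mono) auto
    then show False using \<open>4 * b * (d - ?q) \<le> 1\<close> b by linarith
  qed
  then have "1 * d \<le> \<bar>y\<bar> * \<bar>?q\<bar>" using y1 d by (intro mult_mono) auto
  also have "\<dots> = \<bar>h\<bar>" using xy by (simp add: abs_mult flip: xy)
  finally show False using d by simp
qed

section \<open>Classes and the comparison of the two counts\<close>

definition GL2Z_class :: "cubic \<Rightarrow> cubic set" where
  "GL2Z_class F = GL2Z_equiv `` {F}"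

lemma GL2Z_class_eq_iff: "GL2Z_class F = GL2Z_class G \<longleftrightarrow> (F, G) \<in> GL2Z_equiv"
  unfolding GL2Z_class_def by (rule eq_equiv_class_iff[OF equiv_GL2Z_equiv]) auto

lemma in_GL2Z_class_iff: "G \<in> GL2Z_class F \<longleftrightarrow> (F, G) \<in> GL2Z_equiv"
  by (simp add: GL2Z_class_def)

lemma in_classes_iff: "C \<in> UNIV // GL2Z_equiv \<longleftrightarrow> (\<exists>F. C = GL2Z_class F)"
  by (auto simp: quotient_def GL2Z_class_def)

lemma GL2Z_class_disc:
  assumes "disc F \<noteq> 0" "of_int \<bar>disc F\<bar> < X"
  shows "GL2Z_class F \<in> cubic_classes X"
  using assms disc_GL2Z_equiv unfolding cubic_classes_def in_GL2Z_class_iff in_classes_iff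
  by (auto simp: in_GL2Z_class_iff)

lemma cubic_classes_bound:
  assumes "X \<ge> 1"
  shows "finite (cubic_classes X)" "real (N3 X) \<le> 10014 * X"
proof -
  define L where "L = sqrt (sqrt X)"
  have L: "L \<ge> 1" using assms by (simp add: L_def)
  have "L ^ 4 = (L ^ 2) ^ 2" by simp
  also have "\<dots> = X" using assms by (simp add: L_def)
  finally have L4: "L ^ 4 = X" .
  let ?R = "reduced_nonzero L \<union> reduced_zero L"
  have fin: "finite ?R" using card_reduced_nonzero(1)[OF L] card_reduced_zero(1)[OF L] by simp
  have sub: "cubic_classes X \<subseteq> GL2Z_class ` ?R"
  proof
    fix C assume C: "C \<in> cubic_classes X"
    then obtain F where F: "C = GL2Z_class F" unfolding cubic_classes_def in_classes_iff by blast
    have "(F, F) \<in> GL2Z_equiv" using GL2Z_class_eq_iff by blast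
    then have D: "disc F \<noteq> 0" "of_int \<bar>disc F\<bar> < L ^ 4"
      using C L4 unfolding cubic_classes_def F by (auto simp: in_GL2Z_class_iff)
    have "L > 0" using L by simp
    from reduced_representative[OF D this]
    obtain G where G: "G \<in> ?R" "(F, G) \<in> GL2Z_equiv" by (rule bexE)
    then have "C = GL2Z_class G" unfolding F by (simp add: GL2Z_class_eq_iff)
    then show "C \<in> GL2Z_class ` ?R" using G(1) by (rule image_eqI)
  qed
  show "finite (cubic_classes X)" using fin sub by (rule finite_surj)
  have "N3 X \<le> card ?R" unfolding N3_def by (rule surj_card_le[OF fin sub])
  also have "\<dots> \<le> card (reduced_nonzero L) + card (reduced_zero L)" by (rule card_Un_le)
  finally show "real (N3 X) \<le> 10014 * X"
    using card_reduced_nonzero(2)[OF L] card_reduced_zero(2)[OF L] L4 by linarith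
qed

text \<open>\<open>N3_h\<close> asks for the three properties on every member of a class; this
  transports them from one representative.\<close>

lemma GL2Z_equiv_invariance:
  assumes "(F, G) \<in> GL2Z_equiv"
  shows "locally_represents F h \<Longrightarrow> locally_represents G h"
    and "\<not> globally_represents F h \<Longrightarrow> \<not> globally_represents G h"
    and "maximal_form F \<Longrightarrow> maximal_form G"
proof -
  obtain A where A: "G = form_subst F A"
    using assms unfolding GL2Z_equiv_def by blast
  have "(G, F) \<in> GL2Z_equiv" using assms equiv_GL2Z_equiv unfolding equiv_def by (blast dest: symD)
  then obtain B where B: "F = form_subst G B" "invertible B"
    unfolding GL2Z_equiv_def by blast
  show "locally_represents F h \<Longrightarrow> locally_represents G h"
    using B(1) locally_represents_form_substD by blast
  show "\<not> globally_represents F h \<Longrightarrow> \<not> globally_represents G h"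
    using A globally_represents_form_substD by blast
  assume "maximal_form F"
  show "maximal_form G"
    unfolding maximal_form_def proper_subform_def
  proof clarify
    fix H and M :: "int ^ 2 ^ 2"
    assume M: "\<bar>det M\<bar> > 1" "G = form_subst H M"
    have "F = form_subst H (M ** B)" using B(1) M(2) form_subst_mult by simp
    moreover have "\<bar>det (M ** B)\<bar> > 1"
      using M(1) det_invertible_int[OF B(2)] by (simp add: det_mul abs_mult)
    ultimately show False
      using \<open>maximal_form F\<close> unfolding maximal_form_def proper_subform_def by blast
  qed
qed

text \<open>The discriminant \<open>b^2 - 4 b^3 d\<close> lies between \<open>- 4 b^3 d\<close> and
  0, so every \<open>d\<close> from \<open>|h| + 1\<close> to \<open>X / (4 b^3)\<close> is
  admissible. The lower bound on \<open>X\<close> limits the loss at the ends to half of this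
  range.\<close>

lemma N3_h_lower_bound:
  assumes h: "h \<noteq> 0"
  defines "b \<equiv> 210 * \<bar>h\<bar>"
  assumes X: "X \<ge> 8 * of_int b ^ 3 * (1 + of_int \<bar>h\<bar>)"
  shows "real (N3_h h X) \<ge> X / (8 * of_int b ^ 3)"
proof -
  define T where "T = {C \<in> cubic_classes X.
     \<forall>F \<in> C. locally_represents F h \<and> \<not> globally_represents F h \<and> maximal_form F}"
  define D where "D = \<lfloor>X / (4 * of_int b ^ 3)\<rfloor>"
  have b1: "real_of_int b \<ge> 1" and b0: "b > 0" using h by (simp_all add: b_def)
  have b3: "4 * real_of_int b ^ 3 > 0" using b0 by simp
  have b3': "real_of_int b ^ 3 \<ge> 1" using b1 by simp
  have "1 \<le> 8 * real_of_int b ^ 3" using b3' by linarith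
  then have "1 * 1 \<le> 8 * real_of_int b ^ 3 * (1 + of_int \<bar>h\<bar>)" using b0 by (intro mult_mono) auto
  then have "X \<ge> 1" using X by linarith
  have disc: "disc (Cubic 0 b 1 d) = b ^ 2 - 4 * b ^ 3 * d" for d by (simp add: disc_eq)
  let ?I = "{\<bar>h\<bar> + 1..D}"
  let ?c = "\<lambda>d. GL2Z_class (Cubic 0 b 1 d)"
  have inj: "inj_on ?c ?I"
  proof (rule inj_onI)
    fix d e assume "?c d = ?c e"
    then have "disc (Cubic 0 b 1 d) = disc (Cubic 0 b 1 e)"
      unfolding GL2Z_class_eq_iff using disc_GL2Z_equiv by metis
    then show "d = e" using b0 by (simp add: disc)
  qed
  have img: "?c d \<in> T" if d: "d \<in> ?I" for d
  proof -
    let ?F = "Cubic 0 b 1 d"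
    have "of_int d \<le> X / (4 * of_int b ^ 3)" using d by (simp add: D_def le_floor_iff)
    then have dX: "4 * real_of_int b ^ 3 * of_int d \<le> X" using b3 by (simp add: field_simps)
    have "b ^ 2 * 1 \<le> b ^ 2 * (b * d)" using b0 d by (intro mult_left_mono) (auto simp: int_one_le_iff_zero_less)
    then have "b ^ 2 \<le> b ^ 3 * d" by (simp add: power_numeral_reduce mult_ac)
    moreover have "b ^ 2 > 0" using b0 by simp
    ultimately have D0: "disc ?F < 0" "- disc ?F < 4 * b ^ 3 * d" unfolding disc by linarith+
    then have "real_of_int (- disc ?F) < of_int (4 * b ^ 3 * d)" by (simp only: of_int_less_iff)
    then have "of_int \<bar>disc ?F\<bar> < X" using D0(1) dX by simp
    then have "?c d \<in> cubic_classes X" using D0(1) by (intro GL2Z_class_disc) auto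
    moreover have "locally_represents ?F h" unfolding b_def by (rule locally_represents_family[OF h])
    moreover have "\<not> globally_represents ?F h" using not_globally_represents_family[OF b0 h] d by simp
    ultimately show ?thesis
      unfolding T_def using GL2Z_equiv_invariance maximal_form_family by (simp add: in_GL2Z_class_iff)
  qed
  have "finite T" using cubic_classes_bound(1)[OF \<open>X \<ge> 1\<close>] unfolding T_def by simp
  then have "card ?I \<le> card T" using inj img by (intro card_inj_on_le[of ?c]) auto
  moreover have "real (card ?I) \<ge> X / (4 * of_int b ^ 3) - 1 - of_int \<bar>h\<bar>"
    unfolding D_def card_atLeastAtMost_int by linarith
  moreover have "1 + of_int \<bar>h\<bar> \<le> X / (8 * of_int b ^ 3)"
    using X b3 by (simp add: field_simps)
  moreover have "X / (4 * of_int b ^ 3) = X / (8 * of_int b ^ 3) + X / (8 * of_int b ^ 3)"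
    using b3 by (simp add: field_simps)
  ultimately show ?thesis unfolding N3_h_def T_def[symmetric] by linarith
qed

theorem theorem1p1:
  fixes h :: int
  assumes "h \<noteq> 0"
  shows "Liminf at_top (\<lambda>X :: real. ereal (real (N3_h h X) / real (N3 X))) > 0"
proof -
  define b where "b = 210 * \<bar>h\<bar>"
  define c where "c = 1 / (8 * of_int b ^ 3) / (10014 :: real)"
  have b3: "real_of_int b ^ 3 > 0" using assms by (simp add: b_def)
  have "ereal c \<le> ereal (real (N3_h h X) / real (N3 X))"
    if X: "X \<ge> max 1 (8 * of_int b ^ 3 * (1 + of_int \<bar>h\<bar>))" for X
  proof -
    have lower: "real (N3_h h X) \<ge> X / (8 * of_int b ^ 3)"
      using N3_h_lower_bound[OF assms] X unfolding b_def by simp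
    have upper: "real (N3 X) \<le> 10014 * X" using cubic_classes_bound(2)[of X] X by simp
    have "X / (8 * of_int b ^ 3) > 0" using X b3 by simp
    then have "N3_h h X > 0" using lower by (cases "N3_h h X") auto
    moreover have "N3_h h X \<le> N3 X"
      unfolding N3_h_def N3_def using cubic_classes_bound(1)[of X] X by (intro card_mono) auto
    \<comment> \<open>Needed before comparing quotients, since division by zero yields 0.\<close>
    ultimately have "N3 X > 0" by linarith
    have "c = X / (8 * of_int b ^ 3) / (10014 * X)" using X by (simp add: c_def field_simps)
    also have "\<dots> \<le> real (N3_h h X) / real (N3 X)"
      using lower upper \<open>N3 X > 0\<close> by (intro frac_le) auto
    finally show ?thesis by simp
  qed
  then have "\<forall>\<^sub>F X in at_top. ereal c \<le> ereal (real (N3_h h X) / real (N3 X))"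
    by (rule eventually_at_top_linorderI)
  then have "ereal c \<le> Liminf at_top (\<lambda>X :: real. ereal (real (N3_h h X) / real (N3 X)))"
    by (rule Liminf_bounded)
  moreover have "ereal c > 0" using b3 by (simp add: c_def)
  ultimately show ?thesis by (rule less_le_trans[rotated])
qed

end
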